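(* For all indices $\mathbf k$ and $\mathbf l$, \[\zeta^{s,t,ш}_{\widehat{\mathcal S}}(\mathbf l\,ш_s\,\mathbf k)=(-1)^{\mathrm{wt}(\mathbf l)}\sum_{\mathbf n\in\mathbb Z_{\ge0}^{\mathrm{dep}(\mathbf l)}}b\binom{\mathbf l}{\mathbf n}\,\zeta^{s,t,ш}_{\widehat{\mathcal S}}\bigl(\mathbf k,\overleftarrow{\mathbf l\oplus\mathbf n}\bigr)\,t^{\mathrm{wt}(\mathbf n)},\] where $\zeta^{s,t,ш}_{\widehat{\mathcal S}}(\cdot)$ means $\zeta^{s,t,ш}_{\widehat{\mathcal S}}(\cdot;0,0)$ and $(\mathbf k,\overleftarrow{\mathbf l\oplus\mathbf n})$ is concatenation. In particular the same identity holds for $\zeta^{s,t}_{\widehat{\mathcal S}}$ in $(\mathcal Z/\zeta(2)\mathcal Z)[[s,t]]$.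
   Context: $s,t,T,T_1,T_2$ are commuting indeterminates. Index notation: an index is a finite tuple $\mathbf{k}=(k_1,\dots,k_r)$ of positive integers ($r\ge0$; the empty index is $\varnothing$), with depth $\mathrm{dep}(\mathbf{k})=r$ and weight $\mathrm{wt}(\mathbf{k})=k_1+\cdots+k_r$. For $0\le i\le r$, $\mathbf{k}_{[i]}=(k_1,\dots,k_i)$, $\mathbf{k}^{[i]}=(k_{i+1},\dots,k_r)$, $\overleftarrow{\mathbf{k}}=(k_r,\dots,k_1)$. For tuples of equal length, $\mathbf{k}\oplus\mathbf{l}=(k_1+l_1,\dots,k_r+l_r)$ and $b\binom{\mathbf{k}}{\mathbf{l}}=\prod_{i}\binom{k_i+l_i-1}{l_i}$. Admissible index: empty or $k_r\ge2$; $\zeta(\mathbf{k})=\sum_{0<n_1<\cdots<n_r}n_1^{-k_1}\cdots n_r^{-k_r}$, $\zeta(\varnothing)=1$; $\mathcal Z$ is the $\mathbb Q$-algebra generated by these values. Words: $\mathfrak H=\mathbb Q\langle e_0,e_1\rangle$, $\mathfrak H^1=\mathbb Q+e_1\mathfrak H$, $\mathfrak H^0=\mathbb Q+e_1\mathfrak He_0$, $e_{\mathbf{k}}=e_1e_0^{k_1-1}\cdots e_1e_0^{k_r-1}$ ($e_\varnothing=1$). The shuffle product $ш$ on $\mathfrak H$ is bilinear with $1ш w=wш1=w$, $we_iш w'e_j=(we_iш w')e_j+(wш w'e_j)e_i$; it is extended coefficientwise (bilinearly) to $\mathfrak H[[s]]$. The $s$-shifted shuffle product on $\mathfrak H[[s]]$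 is $w\,ш_s\,w'=(1-e_0s)\bigl(w\,ш\,(1-e_0s)^{-1}w'\bigr)$; it preserves $\mathfrak H^1[[s]]$. Products of (formal linear combinations of) indices are transported via the linear bijection $\mathbf k\mapsto(-1)^{\mathrm{dep}(\mathbf k)}e_{\mathbf k}$ between formal $\mathbb Q$-linear combinations of indices and $\mathfrak H^1$ (coefficientwise in $s$). Maps on indices are extended $\mathbb Q$-linearly and coefficientwise in $s$ (i.e. $\zeta(\sum_m c_ms^m):=\sum_m\zeta(c_m)s^m$). Regularized values: $Z:\mathfrak H^0\to\mathbb R$, $Z(e_{\mathbf k})=(-1)^{\mathrm{dep}(\mathbf k)}\zeta(\mathbf k)$; $Z^{ш}_T:\mathfrak H^1\to\mathbb R[T]$ is the unique $\mathbb Q$-algebra homomorphism for $ш$ extending $Z$ with $Z^{ш}_T(e_1)=-T$; $\zeta^{ш}(\mathbf k;T)=(-1)^{\mathrm{dep}(\mathbf k)}Z^{ш}_T(e_{\mathbf k})$; the same for the harmonic product gives $\zeta^{*}(\mathbf k;T)$. Shifted values: $\zeta^{t,\bullet}_{\mathrm{shift}}(\mathbf{k};T)=\sum_{\mathbf n\in\mathbb Z_{\ge0}^{\mathrm{dep}(\mathbf k)}}b\binom{\mathbf k}{\mathbf n}\zeta^{\bullet}(\mathbf k\oplus\mathbf n;T)(-t)^{\mathrm{wt}(\mathbf n)}$ (also with $t$ replaced by $s$ or $-t$). $(s,t)$-adic SMZVs: $\zeta^{s,t,\bullet}_{\widehat{\mathcal S}}(\mathbf k;T_1,T_2)=\sum_{i=0}^{r}(-1)^{\mathrm{wt}(\mathbf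 k^{[i]})}\zeta^{s,\bullet}_{\mathrm{shift}}(\mathbf k_{[i]};T_1)\zeta^{-t,\bullet}_{\mathrm{shift}}(\overleftarrow{\mathbf k^{[i]}};T_2)$, and $\zeta^{s,t}_{\widehat{\mathcal S}}(\mathbf k)$ is the image of $\zeta^{s,t,\bullet}_{\widehat{\mathcal S}}(\mathbf k;T,T)$ in $(\mathcal Z/\zeta(2)\mathcal Z)[[s,t]]$ (independent of $T,\bullet$). *)

theory Defs
  imports "HOL-Analysis.Analysis"
begin

text \<open>Indices are lists of positive naturals. Words in e0,e1 are letter lists.
 Formal power series are represented coefficientwise: a series in s is a function
 nat \<Rightarrow> _ (coefficient of s^m); a series in s,t is nat \<Rightarrow> nat \<Rightarrow> real
 (coefficient of s^a t^b). Finite formal linear combinations are lists of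
 (coefficient, object) pairs; linear maps act by summation over the list.\<close>

datatype letter = E0 | E1

type_synonym word = "letter list"
type_synonym 'a lc = "(real \<times> 'a) list"

definition is_index :: "nat list \<Rightarrow> bool" where
  "is_index k \<longleftrightarrow> (\<forall>x\<in>set k. 0 < x)"

definition lin :: "('a \<Rightarrow> real) \<Rightarrow> 'a lc \<Rightarrow> real" where
  "lin f xs = (\<Sum>(c,x)\<leftarrow>xs. c * f x)"

definition wt :: "nat list \<Rightarrow> nat" where "wt k = sum_list k"

definition oplus :: "nat list \<Rightarrow> nat list \<Rightarrow> nat list" where
  "oplus k n = map2 (+) k n"

definition bcoef :: "nat list \<Rightarrow> nat list \<Rightarrow> real" where
  "bcoef k n = (\<Prod>i<length k. real ((k!i + n!i - 1) choose (n!i)))"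

definition comps :: "nat \<Rightarrow> nat \<Rightarrow> nat list set" where
  "comps r m = {n. length n = r \<and> sum_list n = m}"

text \<open>multiple zeta value (as a possibly divergent infinite sum; used on admissible indices)\<close>
definition mzv :: "nat list \<Rightarrow> real" where
  "mzv k = infsum (\<lambda>n. \<Prod>i<length k. 1 / real (n!i) ^ (k!i))
      {n. length n = length k \<and> sorted_wrt (<) n \<and> (\<forall>x\<in>set n. 0 < x)}"

fun ew :: "nat list \<Rightarrow> word" where
  "ew [] = []"
| "ew (k#ks) = E1 # replicate (k - 1) E0 @ ew ks"

definition h1 :: "word \<Rightarrow> bool" where
  "h1 w \<longleftrightarrow> w = [] \<or> hd w = E1"

definition h0 :: "word \<Rightarrow> bool" where
  "h0 w \<longleftrightarrow> w = [] \<or> (hd w = E1 \<and> last w = E0)"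

definition idx_of :: "word \<Rightarrow> nat list" where
  "idx_of w = (THE k. is_index k \<and> ew k = w)"

definition dep_w :: "word \<Rightarrow> nat" where "dep_w w = count_list w E1"

definition Zw :: "word \<Rightarrow> real" where
  "Zw w = (-1) ^ dep_w w * mzv (idx_of w)"

text \<open>shuffle product of words, returned as the list of words (with multiplicity);
 defined literally by  w e_i \<sha> w' e_j = (w e_i \<sha> w') e_j + (w \<sha> w' e_j) e_i,
 implemented on reversed words.\<close>
fun shuffle_rev :: "word \<Rightarrow> word \<Rightarrow> word list" where
  "shuffle_rev [] v = [v]"
| "shuffle_rev u [] = [u]"
| "shuffle_rev (a#u) (b#v) =
     map (Cons b) (shuffle_rev (a#u) v) @ map (Cons a) (shuffle_rev u (b#v))"

definition shw :: "word \<Rightarrow> word \<Rightarrow> word list" where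
  "shw u v = map rev (shuffle_rev (rev u) (rev v))"

text \<open>Z^{\<sha>}_T evaluated at a real T: the unique shuffle-algebra homomorphism on H^1
 extending Z with e1 \<mapsto> -T (values on words outside H^1 normalised to 0).\<close>
definition Zsh :: "real \<Rightarrow> word \<Rightarrow> real" where
  "Zsh T = (THE f. f [E1] = - T
      \<and> (\<forall>w. h0 w \<longrightarrow> f w = Zw w)
      \<and> (\<forall>u v. h1 u \<longrightarrow> h1 v \<longrightarrow> sum_list (map f (shw u v)) = f u * f v)
      \<and> (\<forall>w. \<not> h1 w \<longrightarrow> f w = 0))"

definition zeta_sh :: "nat list \<Rightarrow> real \<Rightarrow> real" where
  "zeta_sh k T = (-1) ^ length k * Zsh T (ew k)"

text \<open>sum_{wt n = m} b(k,n) zeta^sh(k+n;T); the coefficient of x^m in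
 zeta^{x,sh}_shift(k;T) is (-1)^m times this, and that of zeta^{-x,sh}_shift is this.\<close>
definition shift_c :: "nat list \<Rightarrow> real \<Rightarrow> nat \<Rightarrow> real" where
  "shift_c k T m = (\<Sum>n\<in>comps (length k) m. bcoef k n * zeta_sh (oplus k n) T)"

definition zetaS :: "real \<Rightarrow> real \<Rightarrow> nat list \<Rightarrow> nat \<Rightarrow> nat \<Rightarrow> real" where
  "zetaS T1 T2 k a b = (\<Sum>i\<le>length k. (-1) ^ wt (drop i k)
      * ((-1) ^ a * shift_c (take i k) T1 a) * shift_c (rev (drop i k)) T2 b)"

definition shw_lc :: "word lc \<Rightarrow> word lc \<Rightarrow> word lc" where
  "shw_lc X Y = concat (map (\<lambda>(c,u). concat (map (\<lambda>(d,v). map (\<lambda>w. (c*d, w)) (shw u v)) Y)) X)"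

definition ser_shw :: "(nat \<Rightarrow> word lc) \<Rightarrow> (nat \<Rightarrow> word lc) \<Rightarrow> nat \<Rightarrow> word lc" where
  "ser_shw W V m = concat (map (\<lambda>i. shw_lc (W i) (V (m - i))) [0..<Suc m])"

text \<open>(1 - e0 s)^{-1} W\<close>
definition geo_e0 :: "(nat \<Rightarrow> word lc) \<Rightarrow> nat \<Rightarrow> word lc" where
  "geo_e0 W m = concat (map (\<lambda>j. map (\<lambda>(c,w). (c, replicate j E0 @ w)) (W (m - j))) [0..<Suc m])"

text \<open>(1 - e0 s) W\<close>
definition ome0 :: "(nat \<Rightarrow> word lc) \<Rightarrow> nat \<Rightarrow> word lc" where
  "ome0 W m = W m @ (if m = 0 then [] else map (\<lambda>(c,w). (- c, E0 # w)) (W (m - 1)))"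

definition shs :: "(nat \<Rightarrow> word lc) \<Rightarrow> (nat \<Rightarrow> word lc) \<Rightarrow> nat \<Rightarrow> word lc" where
  "shs W V = ome0 (ser_shw W (geo_e0 V))"

definition idx_to_ser :: "nat list \<Rightarrow> nat \<Rightarrow> word lc" where
  "idx_to_ser k m = (if m = 0 then [((-1) ^ length k, ew k)] else [])"

definition word_lc_to_idx :: "word lc \<Rightarrow> nat list lc" where
  "word_lc_to_idx X = map (\<lambda>(c,w). ((-1) ^ dep_w w * c, idx_of w)) X"

definition idx_shs :: "nat list \<Rightarrow> nat list \<Rightarrow> nat \<Rightarrow> nat list lc" where
  "idx_shs l k m = word_lc_to_idx (shs (idx_to_ser l) (idx_to_ser k) m)"

text \<open>coefficient of s^a t^b of zeta^{s,t,sh}_{S-hat}(l \<sha>_s k; T1,T2), applying zeta coefficientwise in s\<close>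
definition zetaS_shs :: "real \<Rightarrow> real \<Rightarrow> nat list \<Rightarrow> nat list \<Rightarrow> nat \<Rightarrow> nat \<Rightarrow> real" where
  "zetaS_shs T1 T2 l k a b = (\<Sum>m\<le>a. lin (\<lambda>j. zetaS T1 T2 j (a - m) b) (idx_shs l k m))"

end

theory Submission
  imports Defs
begin

text \<open>
  Let \<open>F\<close> be the shuffle homomorphism on all words with \<open>F(e\<^sub>0) = F(e\<^sub>1) = 0\<close> extending the signed
  multiple zeta values, and let \<open>S\<close> be the antipode of the shuffle algebra. The coefficient of
  \<open>s\<^sup>a t\<^sup>b\<close> in the symmetric value of \<open>k\<close> is, up to the sign \<open>(-1)^dep\<close>, the value \<open>D(e\<^sub>0\<^sup>a e\<^sub>k e\<^sub>1 e\<^sub>0\<^sup>b)\<close>,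
  where \<open>D(w) = \<Sum> F(p) F(S q)\<close> over all factorizations \<open>w = p e\<^sub>1 q\<close>. The functional \<open>D\<close> vanishes on
  shuffle products of nonempty words, which together with the antipode identity gives
  \<open>D((w sh x) e\<^sub>1 y) = D(x e\<^sub>1 (S w sh y))\<close>. For \<open>w = e\<^sub>l\<close>, \<open>x = e\<^sub>0\<^sup>a e\<^sub>k\<close>, \<open>y = e\<^sub>0\<^sup>b\<close> this is the theorem,
  because the factors \<open>1 - e\<^sub>0 s\<close> telescope on the left and
  \<open>e\<^sub>0\<^sup>b sh e\<^sub>l = \<Sum> b(l,n) e\<^bsub>0\<^esub>\<^bsup>b-wt(n)\<^esup> e\<^bsub>l+n\<^esub>\<close> on the right.

  To construct \<open>F\<close>, the shuffle relation for multiple polylogarithms is proved for formal power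
  series (both sides have the same image under \<open>z d/dz\<close>) and evaluated at \<open>z = 1\<close> by Cauchy products
  in the convergent case; the result is then extended across trailing \<open>e\<^sub>1\<close> and leading \<open>e\<^sub>0\<close>.
\<close>

unbundle no vec_syntax
unbundle fps_syntax

section \<open>Sums over shuffles and deconcatenations\<close>

text \<open>Each shuffle is counted with its multiplicity, and \<open>g\<close> receives the
  finished word. The recursion splits off first letters; \<open>sum_list_shw\<close> links it to
  \<open>shw\<close>, which is built from last letters.\<close>

fun shsum :: "'a list \<Rightarrow> 'a list \<Rightarrow> ('a list \<Rightarrow> 'b::comm_monoid_add) \<Rightarrow> 'b" where
  "shsum [] v g = g v"
| "shsum (a # u) [] g = g (a # u)"
| "shsum (a # u) (b # v) g = shsum u (b # v) (\<lambda>w. g (a # w)) + shsum (a # u) v (\<lambda>w. g (b # w))"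

lemma shsum_Nil2 [simp]: "shsum u [] g = g u"
  by (cases u) auto

lemma shsum_cong: "(\<And>w. w \<in> shuffles u v \<Longrightarrow> g w = h w) \<Longrightarrow> shsum u v g = shsum u v h"
proof (induction u v g arbitrary: h rule: shsum.induct)
  case (3 a u b v g)
  have "shsum u (b # v) (\<lambda>w. g (a # w)) = shsum u (b # v) (\<lambda>w. h (a # w))"
    by (rule 3(1)) (simp add: 3(3))
  moreover have "shsum (a # u) v (\<lambda>w. g (b # w)) = shsum (a # u) v (\<lambda>w. h (b # w))"
    by (rule 3(2)) (simp add: 3(3))
  ultimately show ?case by simp
qed auto

lemma shsum_add: "shsum u v (\<lambda>w. g w + h w) = shsum u v g + shsum u v h"
proof (induction u v arbitrary: g h rule: shuffles.induct)
  case (3 a u b v)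
  show ?case by (simp add: 3 add_ac)
qed auto

lemma shsum_zero [simp]: "shsum u v (\<lambda>w. 0) = 0"
  by (induction u v rule: shuffles.induct) auto

lemma shsum_additive:
  assumes "\<phi> 0 = 0" "\<And>x y. \<phi> (x + y) = \<phi> x + \<phi> y"
  shows "shsum u v (\<lambda>w. \<phi> (g w)) = \<phi> (shsum u v g)"
  by (induction u v g rule: shsum.induct) (auto simp: assms)

lemma shsum_cmult: "shsum u v (\<lambda>w. c * g w) = (c::'b::semiring_0) * shsum u v g"
  by (rule shsum_additive) (auto simp: algebra_simps)

lemma shsum_multc: "shsum u v (\<lambda>w. g w * c) = shsum u v g * (c::'b::semiring_0)"
  by (rule shsum_additive[where \<phi> = "\<lambda>x. x * c"]) (auto simp: algebra_simps)

lemma shsum_sum: "shsum u v (\<lambda>w. \<Sum>i\<in>A. g i w) = (\<Sum>i\<in>A. shsum u v (g i))"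
  by (induction A rule: infinite_finite_induct) (auto simp: shsum_add)

lemma shsum_commute: "shsum u v g = shsum v u g"
  by (induction u v g rule: shsum.induct) (auto simp: algebra_simps)

lemma shsum_shsum_swap: "shsum u v (\<lambda>w. shsum x y (g w)) = shsum x y (\<lambda>z. shsum u v (\<lambda>w. g w z))"
proof (induction u v arbitrary: g rule: shuffles.induct)
  case (3 a u b v)
  show ?case
    by (simp add: 3 shsum_add)
qed auto

text \<open>Splitting both sides by which of the three words supplies the first letter gives the
  same three smaller instances.\<close>

lemma shsum_assoc: "shsum u v (\<lambda>w. shsum w t g) = shsum v t (\<lambda>w. shsum u w g)"
proof (induction "length u + length v + length t" arbitrary: u v t g rule: less_induct)
  case less
  show ?case
  proof (cases "u = [] \<or> v = [] \<or> t = []")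
    case True
    then show ?thesis by auto
  next
    case False
    then obtain a u' b v' c t' where [simp]: "u = a # u'" "v = b # v'" "t = c # t'"
      by (metis neq_Nil_conv)
    have *: "shsum u v (\<lambda>w. shsum w t g) =
        shsum u' v (\<lambda>w. shsum w t (\<lambda>x. g (a # x))) + shsum u v' (\<lambda>w. shsum w t (\<lambda>x. g (b # x)))
        + shsum u v (\<lambda>w. shsum w t' (\<lambda>x. g (c # x)))"
      by (simp add: shsum_add algebra_simps)
    have **: "shsum v t (\<lambda>w. shsum u w g) =
        shsum v t (\<lambda>w. shsum u' w (\<lambda>x. g (a # x))) + shsum v' t (\<lambda>w. shsum u w (\<lambda>x. g (b # x)))
        + shsum v t' (\<lambda>w. shsum u w (\<lambda>x. g (c # x)))"
      by (simp add: shsum_add algebra_simps)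
    show ?thesis unfolding * **
      by (intro arg_cong2[where f = "(+)"] less) auto
  qed
qed

lemma shsum_snoc:
  "shsum (u @ [a]) (v @ [b]) g = shsum u (v @ [b]) (\<lambda>w. g (w @ [a])) + shsum (u @ [a]) v (\<lambda>w. g (w @ [b]))"
proof (induction u v g rule: shsum.induct)
  case (1 v g)
  then show ?case
    by (induction v arbitrary: g) (auto simp: algebra_simps)
next
  case (2 c u g)
  then show ?case
  proof (induction u arbitrary: c g)
    case Nil
    then show ?case by (auto simp: algebra_simps)
  next
    case (Cons d u)
    have "shsum (d # u @ [a]) [b] (\<lambda>w. g (c # w)) = shsum (d # u) [b] (\<lambda>w. g (c # w @ [a])) + g (c # d # u @ [a, b])"
      using Cons[of d "\<lambda>w. g (c # w)"] by simp
    then show ?case by (simp add: algebra_simps)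
  qed
next
  case (3 c u d v g)
  then show ?case by (simp add: algebra_simps)
qed

lemma shsum_rev: "shsum (rev u) (rev v) g = shsum u v (\<lambda>w. g (rev w))"
  by (induction u v arbitrary: g rule: shuffles.induct) (auto simp: shsum_snoc)

lemma sum_list_shuffle_rev: "sum_list (map g (shuffle_rev u v)) = shsum u v g"
  by (induction u v arbitrary: g rule: shuffle_rev.induct) (auto simp: o_def algebra_simps)

lemma sum_list_shw: "sum_list (map g (shw u v)) = shsum u v g"
  using sum_list_shuffle_rev[of "\<lambda>w. g (rev w)" "rev u" "rev v"] shsum_rev[of "rev u" "rev v" g]
  by (simp add: shw_def o_def)

lemma shsum_replicate:
  "shsum (replicate i a) (replicate j a) g = of_nat ((i + j) choose i) * (g (replicate (i + j) a) :: 'b::semiring_1)"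
proof (induction i arbitrary: j g)
  case (Suc i)
  note IH = Suc.IH
  show ?case
  proof (induction j arbitrary: g)
    case (Suc j)
    show ?case
      using IH[of "Suc j" "\<lambda>w. g (a # w)"] Suc.IH[of "\<lambda>w. g (a # w)"]
      by (simp add: distrib_right)
  qed simp
qed simp

section \<open>Deconcatenation, the coproduct dual to concatenation, and the antipode
  identity\<close>

definition dcsum :: "'a list \<Rightarrow> ('a list \<Rightarrow> 'a list \<Rightarrow> 'b::comm_monoid_add) \<Rightarrow> 'b" where
  "dcsum w h = (\<Sum>i\<le>length w. h (take i w) (drop i w))"

lemma dcsum_Nil [simp]: "dcsum [] h = h [] []"
  by (simp add: dcsum_def)

lemma dcsum_Cons: "dcsum (a # w) h = h [] (a # w) + dcsum w (\<lambda>p q. h (a # p) q)"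
  by (simp add: dcsum_def sum.atMost_Suc_shift del: sum.atMost_Suc)

lemma dcsum_snoc: "dcsum (w @ [a]) h = dcsum w (\<lambda>p q. h p (q @ [a])) + h (w @ [a]) []"
  by (simp add: dcsum_def)

lemma dcsum_cong: "(\<And>p q. w = p @ q \<Longrightarrow> h p q = h' p q) \<Longrightarrow> dcsum w h = dcsum w h'"
  unfolding dcsum_def by (intro sum.cong) auto

lemma dcsum_add: "dcsum w (\<lambda>p q. h p q + h' p q) = dcsum w h + dcsum w h'"
  by (simp add: dcsum_def sum.distrib)

lemma dcsum_cmult: "dcsum w (\<lambda>p q. c * h p q) = (c::'b::semiring_0) * dcsum w h"
  by (simp add: dcsum_def sum_distrib_left)

lemma shsum_dcsum: "shsum u v (\<lambda>w. dcsum z (\<lambda>p q. h w p q)) = dcsum z (\<lambda>p q. shsum u v (\<lambda>w. h w p q))"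
  by (simp add: dcsum_def shsum_sum)

lemma dcsum_only_Nil_left:
  assumes "\<And>p q. w = p @ q \<Longrightarrow> p \<noteq> [] \<Longrightarrow> h p q = 0"
  shows "dcsum w h = h [] w"
proof (cases w)
  case (Cons a w')
  have "dcsum w' (\<lambda>p q. h (a # p) q) = dcsum w' (\<lambda>p q. 0)"
    by (rule dcsum_cong) (simp add: assms Cons)
  also have "\<dots> = 0" by (simp add: dcsum_def)
  finally show ?thesis by (simp add: Cons dcsum_Cons)
qed simp

lemma dcsum_only_Nil_right:
  assumes "\<And>p q. w = p @ q \<Longrightarrow> q \<noteq> [] \<Longrightarrow> h p q = 0"
  shows "dcsum w h = h w []"
proof (cases w rule: rev_cases)
  case (snoc w' a)
  have "dcsum w' (\<lambda>p q. h p (q @ [a])) = dcsum w' (\<lambda>p q. 0)"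
    by (rule dcsum_cong) (simp add: assms snoc)
  also have "\<dots> = 0" by (simp add: dcsum_def)
  finally show ?thesis by (simp add: snoc dcsum_snoc)
qed simp

lemma dcsum_coassoc: "dcsum w (\<lambda>p q. dcsum p (\<lambda>r s. h r s q)) = dcsum w (\<lambda>r x. dcsum x (\<lambda>s q. h r s q))"
proof (induction w arbitrary: h)
  case (Cons a w)
  show ?case
    using Cons[of "\<lambda>r s q. h (a # r) s q"]
    by (simp add: dcsum_Cons dcsum_add add.assoc)
qed simp

text \<open>The marked letter \<open>a\<close> of the second word divides each shuffle: a prefix
  \<open>p\<close> of \<open>w\<close> interlaces with \<open>x\<close> in front of it, the rest
  with \<open>y\<close> behind it.\<close>

lemma shsum_append_Cons:
  "shsum w (x @ a # y) g = dcsum w (\<lambda>p q. shsum p x (\<lambda>r. shsum q y (\<lambda>s. g (r @ a # s))))"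
proof (induction w x arbitrary: g rule: shuffles.induct)
  case (1 x)
  then show ?case by simp
next
  case (2 w)
  then show ?case
    by (induction w arbitrary: g) (auto simp: dcsum_Cons add.commute)
next
  case (3 c w d x)
  have "shsum (c # w) (x @ a # y) (\<lambda>w. g (d # w)) =
      shsum x [] (\<lambda>r. shsum (c # w) y (\<lambda>s. g (d # r @ a # s)))
      + dcsum w (\<lambda>p q. shsum (c # p) x (\<lambda>r. shsum q y (\<lambda>s. g (d # r @ a # s))))"
    using 3(2)[of "\<lambda>w. g (d # w)"] by (simp add: dcsum_Cons)
  then show ?case
    using 3(1)[of "\<lambda>w. g (c # w)"]
    by (simp add: dcsum_Cons dcsum_add algebra_simps)
qed

text \<open>The shuffles of \<open>p\<close> and \<open>rev q\<close> end either in the last letter of \<open>p\<close> or in the first letter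
  of \<open>q\<close>, so the alternating sum telescopes.\<close>

lemma dcsum_antipode:
  assumes "w \<noteq> []"
  shows "dcsum w (\<lambda>p q. (-1) ^ length q * shsum p (rev q) g) = (0::'b::comm_ring_1)"
proof -
  define n where "n = length w"
  \<comment> \<open>\<open>A i\<close> collects the shuffles ending in \<open>w ! i\<close>; it
    occurs for the cut just before this letter and for the cut just after it, with opposite
    signs.\<close>
  define A where "A i = shsum (take i w) (rev (drop (Suc i) w)) (\<lambda>x. g (x @ [w ! i]))" for i
  define sg :: "nat \<Rightarrow> 'b" where "sg i = (-1) ^ (n - i)" for i
  have n: "n > 0" using assms by (simp add: n_def)
  have drop: "drop i w = w ! i # drop (Suc i) w" if "i < n" for i
    using that by (simp add: n_def Cons_nth_drop_Suc)
  have take: "take (Suc i) w = take i w @ [w ! i]" if "i < n" for i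
    using that by (simp add: n_def take_Suc_conv_app_nth)
  have mid: "shsum (take (Suc i) w) (rev (drop (Suc i) w)) g = A i + A (Suc i)" if "Suc i < n" for i
    using that by (simp add: take drop[of "Suc i"] shsum_snoc A_def)
  have zero: "shsum (take 0 w) (rev (drop 0 w)) g = A 0"
  proof -
    have "rev w = rev (drop (Suc 0) w) @ [w ! 0]"
      using drop[of 0] n by (metis drop0 rev.simps(2))
    then show ?thesis by (simp add: A_def)
  qed
  have last: "shsum (take n w) (rev (drop n w)) g = A (n - 1)"
    using n take[of "n - 1"] by (simp add: A_def n_def)
  have "dcsum w (\<lambda>p q. (-1) ^ length q * shsum p (rev q) g) =
      (\<Sum>i\<le>n. sg i * shsum (take i w) (rev (drop i w)) g)"
    by (simp add: dcsum_def n_def sg_def)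
  also have "\<dots> = (\<Sum>i\<le>n. (if i < n then sg i * A i else 0) + (if 0 < i then sg i * A (i - 1) else 0))"
  proof (intro sum.cong refl)
    fix i assume "i \<in> {..n}"
    then consider "i = 0" | "i = n" | j where "i = Suc j" "Suc j < n"
      by (cases i) (auto simp: le_less)
    then show "sg i * shsum (take i w) (rev (drop i w)) g =
        (if i < n then sg i * A i else 0) + (if 0 < i then sg i * A (i - 1) else 0)"
    proof cases
      case 1 then show ?thesis using n zero by simp
    next
      case 2 then show ?thesis using n last by simp
    next
      case 3 then show ?thesis using mid[of j] by (simp add: algebra_simps)
    qed
  qed
  also have "\<dots> = (\<Sum>i<n. sg i * A i) + (\<Sum>i<n. sg (Suc i) * A i)"
  proof -
    have "(\<Sum>i\<le>n. (if i < n then sg i * A i else 0)) = (\<Sum>i<n. sg i * A i)"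
      by (simp add: lessThan_Suc_atMost[symmetric])
    moreover have "(\<Sum>i\<le>n. (if 0 < i then sg i * A (i - 1) else 0)) = (\<Sum>i<n. sg (Suc i) * A i)"
      by (simp add: lessThan_Suc_atMost[symmetric] sum.lessThan_Suc_shift del: sum.lessThan_Suc)
    ultimately show ?thesis by (simp add: sum.distrib)
  qed
  also have "\<dots> = 0"
  proof -
    have "sg (Suc i) = - sg i" if "i < n" for i
    proof -
      have "n - i = Suc (n - Suc i)" using that by simp
      then show ?thesis by (simp add: sg_def)
    qed
    then show ?thesis by (simp add: sum.distrib[symmetric] algebra_simps)
  qed
  finally show ?thesis .
qed

text \<open>Expanding the first factor on the right by deconcatenation, the antipode identity shows
  \<open>(w sh x) a y = \<Sum> p sh (x a (S(q) sh y))\<close> over \<open>w = p q\<close>; only \<open>p = []\<close> survives under \<open>g\<close>.\<close>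

lemma shsum_antipode_transfer:
  fixes g :: "'a list \<Rightarrow> 'b::comm_ring_1"
  assumes kill: "\<And>p r q. w = p @ r \<Longrightarrow> p \<noteq> [] \<Longrightarrow> q \<in> shuffles (rev r) y \<Longrightarrow> shsum p (x @ a # q) g = 0"
  shows "shsum w x (\<lambda>p. g (p @ a # y)) = (-1) ^ length w * shsum (rev w) y (\<lambda>q. g (x @ a # q))"
proof -
  have "(-1) ^ length w * shsum (rev w) y (\<lambda>q. g (x @ a # q)) =
      dcsum w (\<lambda>p q. (-1) ^ length q * shsum (rev q) y (\<lambda>z. shsum p (x @ a # z) g))"
  proof (subst dcsum_only_Nil_left)
    fix p q assume w: "w = p @ q" "p \<noteq> []"
    have "shsum (rev q) y (\<lambda>z. shsum p (x @ a # z) g) = shsum (rev q) y (\<lambda>z. 0)"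
      by (rule shsum_cong) (use kill w in blast)
    then show "(-1) ^ length q * shsum (rev q) y (\<lambda>z. shsum p (x @ a # z) g) = 0" by simp
  qed simp
  also have "\<dots> = dcsum w (\<lambda>p q. dcsum p (\<lambda>r s. (-1) ^ length q *
      shsum (rev q) y (\<lambda>z. shsum r x (\<lambda>r'. shsum s z (\<lambda>s'. g (r' @ a # s'))))))"
    by (simp add: shsum_append_Cons shsum_dcsum dcsum_cmult)
  also have "\<dots> = dcsum w (\<lambda>r t. dcsum t (\<lambda>s q. (-1) ^ length q *
      shsum (rev q) y (\<lambda>z. shsum r x (\<lambda>r'. shsum s z (\<lambda>s'. g (r' @ a # s'))))))"
    by (rule dcsum_coassoc)
  \<comment> \<open>Associativity groups \<open>s\<close> with \<open>rev q\<close>, so that the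
    antipode identity can annihilate every nonempty \<open>t\<close>.\<close>
  also have "\<dots> = dcsum w (\<lambda>r t. shsum r x (\<lambda>r'. dcsum t (\<lambda>s q. (-1) ^ length q *
      shsum s (rev q) (\<lambda>z. shsum z y (\<lambda>s'. g (r' @ a # s'))))))"
    by (simp add: shsum_dcsum shsum_cmult shsum_assoc) (simp add: shsum_shsum_swap[of _ x])
  also have "\<dots> = shsum w x (\<lambda>p. g (p @ a # y))"
    by (subst dcsum_only_Nil_right) (simp_all add: dcsum_antipode)
  finally show ?thesis by simp
qed

section \<open>Cutting words at the occurrences of one letter\<close>

definition cutsum :: "'a \<Rightarrow> 'a list \<Rightarrow> ('a list \<Rightarrow> 'a list \<Rightarrow> 'b::comm_monoid_add) \<Rightarrow> 'b" where
  "cutsum a w h = (\<Sum>i<length w. if w ! i = a then h (take i w) (drop (Suc i) w) else 0)"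

lemma cutsum_Nil [simp]: "cutsum a [] h = 0"
  by (simp add: cutsum_def)

lemma cutsum_Cons: "cutsum a (c # w) h = (if c = a then h [] w else 0) + cutsum a w (\<lambda>p q. h (c # p) q)"
  by (simp add: cutsum_def sum.lessThan_Suc_shift del: sum.lessThan_Suc cong: if_cong)

lemma cutsum_add: "cutsum a w (\<lambda>p q. h p q + h' p q) = cutsum a w h + cutsum a w h'"
  unfolding cutsum_def sum.distrib[symmetric] by (intro sum.cong) auto

lemma cutsum_append: "a \<notin> set x \<Longrightarrow> cutsum a (x @ w) h = cutsum a w (\<lambda>p q. h (x @ p) q)"
  by (induction x arbitrary: h) (auto simp: cutsum_Cons)

text \<open>The marked \<open>a\<close> stems from \<open>u\<close> or from \<open>v\<close>; the
  other word is cut at an arbitrary place, and each half is shuffled with the part on its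
  side.\<close>

lemma shsum_cutsum:
  "shsum u v (\<lambda>w. cutsum a w h) =
     cutsum a u (\<lambda>p q. dcsum v (\<lambda>r s. shsum p r (\<lambda>x. shsum q s (h x))))
     + cutsum a v (\<lambda>r s. dcsum u (\<lambda>p q. shsum p r (\<lambda>x. shsum q s (h x))))"
proof (induction u v arbitrary: h rule: shuffles.induct)
  case (1 v)
  then show ?case by simp
next
  case (2 u)
  then show ?case by simp
next
  case (3 c u d v)
  show ?case
    by (simp add: 3 cutsum_Cons dcsum_Cons cutsum_add dcsum_add shsum_add add_ac)
qed

lemma shsum_sign:
  "shsum u v (\<lambda>w. (-1) ^ length w * g (rev w)) =
     (-1) ^ (length u + length v) * (shsum (rev u) (rev v) g :: 'b::comm_ring_1)"
proof -
  have "shsum u v (\<lambda>w. (-1) ^ length w * g (rev w)) = shsum u v (\<lambda>w. (-1) ^ (length u + length v) * g (rev w))"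
    by (rule shsum_cong) (auto dest: length_shuffles)
  then show ?thesis by (simp add: shsum_cmult shsum_rev)
qed

text \<open>The coefficients of \<open>\<Phi> a \<Phi>\<^sup>-\<^sup>1\<close>, if \<open>\<Phi>\<close> is the group-like series with coefficients \<open>F\<close>.\<close>

definition cutconv :: "'a \<Rightarrow> ('a list \<Rightarrow> 'b::comm_ring_1) \<Rightarrow> 'a list \<Rightarrow> 'b" where
  "cutconv a F w = cutsum a w (\<lambda>p q. F p * ((-1) ^ length q * F (rev q)))"

text \<open>In \<open>shsum_cutsum\<close> every term factors, and the word not cut at
  \<open>a\<close> contributes the convolution of \<open>F\<close> with its composite with the
  antipode, which is \<open>0\<close> on nonempty words. Equivalently, conjugating a letter by a
  group-like series gives a primitive series.\<close>

lemma shsum_cutconv: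
  fixes F :: "'a list \<Rightarrow> 'b::comm_ring_1"
  assumes hom: "\<And>u v. shsum u v F = F u * F v" and "u \<noteq> []" "v \<noteq> []"
  shows "shsum u v (cutconv a F) = 0"
proof -
  define G where "G q = (-1) ^ length q * F (rev q)" for q
  have G: "shsum q s G = G q * G s" for q s
    unfolding G_def by (simp add: shsum_sign hom power_add)
  have anti: "dcsum w (\<lambda>p q. F p * G q) = 0" if "w \<noteq> []" for w
    using dcsum_antipode[OF that, of F] by (simp add: hom G_def mult_ac)
  have eq: "shsum p r (\<lambda>x. shsum q s (\<lambda>y. F x * G y)) = (F p * G q) * (F r * G s)" for p q r s
    by (simp add: shsum_cmult shsum_multc hom G)
  show ?thesis
    unfolding cutconv_def G_def[symmetric] shsum_cutsum eq
    using anti assms(2,3) by (simp add: dcsum_cmult mult.commute[of "F _ * G _" "F _ * G _"] cutsum_def)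
qed

section \<open>Regularization with respect to a letter\<close>

text \<open>The set \<open>C\<close> selects the domain of a homomorphism: \<open>{E1}\<close> gives
  the words of H^1 read backwards, \<open>UNIV\<close> all words.\<close>

definition ends :: "'a set \<Rightarrow> 'a list \<Rightarrow> bool" where
  "ends C w \<longleftrightarrow> w = [] \<or> last w \<in> C"

definition nonlead :: "'a \<Rightarrow> 'a list \<Rightarrow> bool" where
  "nonlead a w \<longleftrightarrow> w = [] \<or> hd w \<noteq> a"

lemma ends_tl: "ends C (b # y) \<Longrightarrow> ends C y"
  by (cases "y = []") (auto simp: ends_def)

lemma ends_appendD: "ends C (x @ y) \<Longrightarrow> ends C y"
  by (cases "y = []") (auto simp: ends_def)

lemma ends_replicate: "a \<in> C \<Longrightarrow> ends C (replicate i a)"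
  by (cases "i = 0") (auto simp: ends_def)

lemma ends_shuffles: "w \<in> shuffles u v \<Longrightarrow> ends C u \<Longrightarrow> ends C v \<Longrightarrow> ends C w"
proof (induction u v arbitrary: w rule: shuffles.induct)
  case (3 a u b v)
  from 3(3) consider w' where "w = a # w'" "w' \<in> shuffles u (b # v)"
    | w' where "w = b # w'" "w' \<in> shuffles (a # u) v" by auto
  then show ?case
  proof cases
    case 1
    then have "w' \<noteq> []" by auto
    moreover have "ends C w'" using 3(1)[OF 1(2) ends_tl[OF 3(4)] 3(5)] .
    ultimately show ?thesis by (simp add: 1 ends_def)
  next
    case 2
    then have "w' \<noteq> []" by auto
    moreover have "ends C w'" using 3(2)[OF 2(2) 3(4) ends_tl[OF 3(5)]] .
    ultimately show ?thesis by (simp add: 2 ends_def)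
  qed
qed auto

lemma ends_Cons_shuffles:
  assumes "q \<in> shuffles p y" "ends C p" "ends C (b # y)"
  shows "ends C (b # q)"
proof (cases "q = []")
  case True
  with assms show ?thesis by auto
next
  case False
  have "ends C q" using ends_shuffles assms ends_tl by metis
  with False show ?thesis by (simp add: ends_def)
qed

lemma nonlead_shuffles: "w \<in> shuffles u v \<Longrightarrow> nonlead a u \<Longrightarrow> nonlead a v \<Longrightarrow> nonlead a w"
  by (cases u; cases v) (auto simp: nonlead_def)

lemma nonlead_Cons [simp]: "nonlead a (b # y) \<longleftrightarrow> b \<noteq> a"
  by (simp add: nonlead_def)

lemma lead_decomp:
  obtains m y where "w = replicate m a @ y" "nonlead a y"
proof (induction w arbitrary: thesis)
  case Nil
  show ?case by (rule Nil[of 0 "[]"]) (auto simp: nonlead_def)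
next
  case (Cons b w)
  show ?case
  proof (cases "b = a")
    case True
    obtain m y where "w = replicate m a @ y" "nonlead a y" using Cons.IH .
    with True show ?thesis by (intro Cons.prems[of "Suc m" y]) auto
  next
    case False
    then show ?thesis by (intro Cons.prems[of 0 "b # w"]) (auto simp: nonlead_def)
  qed
qed

text \<open>The formula is forced by \<open>shsum_antipode_transfer\<close> with \<open>x = []\<close> and \<open>w\<close> a power of \<open>a\<close>.\<close>

definition reg :: "'a \<Rightarrow> ('a list \<Rightarrow> 'b::comm_ring_1) \<Rightarrow> 'a list \<Rightarrow> 'b" where
  "reg a g w = (case dropWhile ((=) a) w of [] \<Rightarrow> if w = [] then 1 else 0
     | b # y \<Rightarrow> let m = length (takeWhile ((=) a) w) in (-1) ^ m * shsum (replicate m a) y (\<lambda>q. g (b # q)))"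

lemma reg_Cons:
  assumes "b \<noteq> a"
  shows "reg a g (replicate m a @ b # y) = (-1) ^ m * shsum (replicate m a) y (\<lambda>q. g (b # q))"
proof -
  have "dropWhile ((=) a) (replicate m a @ b # y) = b # y" 
       "takeWhile ((=) a) (replicate m a @ b # y) = replicate m a"
    using assms by (induction m) auto
  then show ?thesis by (simp add: reg_def)
qed

lemma reg_replicate: "reg a g (replicate m a) = (if m = 0 then 1 else 0)"
  by (simp add: reg_def)

lemma reg_nonlead:
  assumes "nonlead a w" "g [] = 1"
  shows "reg a g w = g w"
  using assms reg_Cons[of "hd w" a g 0 "tl w"] reg_replicate[of a g 0]
  by (cases w) (auto simp: nonlead_def)

text \<open>The new \<open>a\<close> either joins the leading block, where \<open>Suc m\<close>
  positions give the same word, or lands behind the first other letter \<open>b\<close>.\<close>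

lemma shsum_single_lead:
  "shsum [a] (replicate m a @ y) h = of_nat (Suc m) * h (replicate (Suc m) a @ y)
     + (case y of [] \<Rightarrow> 0 | b # y' \<Rightarrow> shsum [a] y' (\<lambda>q. h (replicate m a @ b # q) :: 'b::comm_ring_1))"
  by (induction m arbitrary: h) (auto split: list.split simp: algebra_simps)

text \<open>Both parts of \<open>shsum_single_lead\<close> are the same multiple of one shuffle sum,
  with opposite signs.\<close>

lemma shsum_single_reg: "shsum [a] w (reg a g) = 0"
proof -
  obtain m y where w: "w = replicate m a @ y" "nonlead a y" by (rule lead_decomp)
  show ?thesis
  proof (cases y)
    case Nil
    then show ?thesis
      using shsum_single_lead[of a m "[]" "reg a g"] reg_replicate[of a g "Suc m"] by (simp add: w)
  next
    case (Cons b y')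
    then have b: "b \<noteq> a" using w by simp
    define G where "G q = g (b # q)" for q
    have "shsum [a] y' (\<lambda>q. shsum (replicate m a) q G) = shsum (replicate m a) (replicate 1 a) (\<lambda>w. shsum w y' G)"
      by (simp add: shsum_assoc)
    also have "\<dots> = of_nat (Suc m) * shsum (replicate (Suc m) a) y' G"
      unfolding shsum_replicate by simp
    finally have "shsum [a] y' (\<lambda>q. reg a g (replicate m a @ b # q)) =
        (-1) ^ m * (of_nat (Suc m) * shsum (replicate (Suc m) a) y' G)"
      by (simp add: reg_Cons[OF b] shsum_cmult G_def[symmetric] del: replicate_Suc)
    then show ?thesis
      unfolding w Cons shsum_single_lead by (simp add: reg_Cons[OF b] G_def[symmetric] del: replicate_Suc)
  qed
qed

text \<open>Since \<open>G\<close> kills shuffles with \<open>a\<close>, a leading \<open>a\<close> can be moved inside the word, and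
  multiplicativity follows by induction on the number of leading letters \<open>a\<close>.\<close>

lemma hom_lead_step:
  fixes G :: "'a list \<Rightarrow> real"
  assumes kill: "\<And>w. shsum [a] w G = 0"
    and base: "\<And>u. ends C u \<Longrightarrow> nonlead a u \<Longrightarrow> shsum u v G = G u * G v"
    and C: "a \<in> C" and u: "ends C u"
  shows "shsum u v G = G u * G v"
proof -
  have "shsum (replicate m a @ y) v G = G (replicate m a @ y) * G v"
    if "ends C y" "nonlead a y" for m y using that
  proof (induction m arbitrary: y)
    case 0
    then show ?case by (simp add: base)
  next
    case (Suc m)
    \<comment> \<open>The part of \<open>shsum_single_lead\<close> in which \<open>a\<close> lands
      behind the leading block; its words have only \<open>m\<close> leading letters from that
      block, so the induction hypothesis applies.\<close>
    define R where "R h = (case y of [] \<Rightarrow> 0 | b # y' \<Rightarrow> shsum [a] y' (\<lambda>q. h (replicate m a @ b # q)))" for h :: "'a list \<Rightarrow> real"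
    have R: "R (\<lambda>w. shsum w v G) = R G * G v"
    proof (cases y)
      case (Cons b y')
      have "shsum [a] y' (\<lambda>q. shsum (replicate m a @ b # q) v G) = shsum [a] y' (\<lambda>q. G (replicate m a @ b # q) * G v)"
      proof (rule shsum_cong)
        fix q assume "q \<in> shuffles [a] y'"
        then have "ends C (b # q)"
          by (rule ends_Cons_shuffles) (use Suc.prems C Cons in \<open>auto simp: ends_def\<close>)
        then show "shsum (replicate m a @ b # q) v G = G (replicate m a @ b # q) * G v"
          using Suc.IH[of "b # q"] Suc.prems Cons by auto
      qed
      then show ?thesis by (simp add: R_def Cons shsum_multc)
    qed (simp add: R_def)
    have "0 = shsum (replicate m a @ y) v (\<lambda>w. shsum [a] w G)" by (simp add: kill)
    also have "\<dots> = shsum [a] (replicate m a @ y) (\<lambda>w. shsum w v G)" by (simp only: shsum_assoc)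
    also have "\<dots> = of_nat (Suc m) * shsum (replicate (Suc m) a @ y) v G + R G * G v"
      using R unfolding shsum_single_lead R_def by simp
    finally have 1: "0 = of_nat (Suc m) * shsum (replicate (Suc m) a @ y) v G + R G * G v" .
    have 2: "0 = of_nat (Suc m) * G (replicate (Suc m) a @ y) + R G"
      using kill[of "replicate m a @ y"] unfolding shsum_single_lead R_def[symmetric] by simp
    have "of_nat (Suc m) * shsum (replicate (Suc m) a @ y) v G =
        of_nat (Suc m) * (G (replicate (Suc m) a @ y) * G v)"
      using 1 arg_cong[OF 2, of "\<lambda>x. x * G v"] by (simp only: algebra_simps)
    then show ?case by (simp only: mult_cancel_left) simp
  qed
  moreover obtain m y where "u = replicate m a @ y" "nonlead a y" by (rule lead_decomp)
  moreover from this u have "ends C y" by (auto dest: ends_appendD)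
  ultimately show ?thesis by simp
qed

text \<open>Leading letters are removed from \<open>u\<close> and then, with the factors exchanged,
  from \<open>v\<close>; on the remaining words \<open>reg a g\<close> agrees with
  \<open>g\<close>.\<close>

lemma reg_hom:
  fixes g :: "'a list \<Rightarrow> real"
  assumes hom: "\<And>u v. ends C u \<Longrightarrow> ends C v \<Longrightarrow> nonlead a u \<Longrightarrow> nonlead a v \<Longrightarrow> shsum u v g = g u * g v"
    and g: "g [] = 1" and C: "a \<in> C" and "ends C u" "ends C v"
  shows "shsum u v (reg a g) = reg a g u * reg a g v"
proof (rule hom_lead_step[OF shsum_single_reg _ C \<open>ends C u\<close>])
  fix u assume u: "ends C u" "nonlead a u"
  have "shsum v u (reg a g) = reg a g v * reg a g u"
  proof (rule hom_lead_step[OF shsum_single_reg _ C \<open>ends C v\<close>])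
    fix v assume v: "ends C v" "nonlead a v"
    have "shsum v u (reg a g) = shsum v u g"
      by (rule shsum_cong) (use nonlead_shuffles reg_nonlead g u v in metis)
    then show "shsum v u (reg a g) = reg a g v * reg a g u"
      using u v by (simp add: reg_nonlead g hom)
  qed
  then show "shsum u v (reg a g) = reg a g u * reg a g v"
    by (simp add: shsum_commute[of u v] mult.commute)
qed

text \<open>Uniqueness of the regularization: \<open>g [a] = 0\<close> forces \<open>g\<close> to
  vanish on all nonempty powers of \<open>a\<close>, and \<open>shsum_antipode_transfer\<close> then
  yields the formula defining \<open>reg\<close>.\<close>

lemma hom_eq_reg:
  fixes g :: "'a list \<Rightarrow> real"
  assumes hom: "\<And>u v. ends C u \<Longrightarrow> ends C v \<Longrightarrow> shsum u v g = g u * g v"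
    and g: "g [a] = 0" "g [] = 1" and C: "a \<in> C" and w: "ends C w"
  shows "g w = reg a g w"
proof -
  have rep: "ends C (replicate i a)" for i
    using C by (rule ends_replicate)
  have pow: "g (replicate (Suc i) a) = 0" for i
  proof -
    have "of_nat (Suc i) * g (replicate (Suc i) a) = g (replicate 1 a) * g (replicate i a)"
      using hom[OF rep[of 1] rep[of i]] unfolding shsum_replicate by simp
    then show ?thesis using g by simp
  qed
  obtain m y where w': "w = replicate m a @ y" "nonlead a y" by (rule lead_decomp)
  show ?thesis
  proof (cases y)
    case Nil
    then show ?thesis using w' pow g reg_replicate[of a g m] by (cases m) auto
  next
    case (Cons b y')
    have by': "ends C (b # y')" using w w' Cons by (auto simp: ends_def)
    have b: "b \<noteq> a" using w' Cons by simp
    have "shsum (replicate m a) [] (\<lambda>p. g (p @ b # y')) =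
        (-1) ^ length (replicate m a) * shsum (rev (replicate m a)) y' (\<lambda>q. g ([] @ b # q))"
    proof (rule shsum_antipode_transfer)
      fix p r q assume p: "replicate m a = p @ r" "p \<noteq> []" and q: "q \<in> shuffles (rev r) y'"
      have "p = replicate (length p) a" "r = replicate (length r) a"
        using p(1) by (metis append_eq_conv_conj take_replicate length_replicate length_append min.absorb1 le_add1)
           (metis append_eq_conv_conj drop_replicate length_replicate length_append p(1))
      then obtain i j where pr: "p = replicate (Suc i) a" "r = replicate j a"
        using p(2) by (metis length_0_conv not0_implies_Suc)
      have "ends C (b # q)"
        using q by (rule ends_Cons_shuffles) (use rep by' pr in auto)
      then have "shsum p (b # q) g = g p * g (b # q)" using hom rep pr by metis
      then show "shsum p ([] @ b # q) g = 0" using pow pr by simp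
    qed
    then show ?thesis by (simp add: w' Cons reg_Cons[OF b])
  qed
qed

lemma reg_cong:
  assumes "\<And>w. ends C w \<Longrightarrow> nonlead a w \<Longrightarrow> g w = h w" "ends C w" "a \<in> C"
  shows "reg a g w = reg a h w"
proof -
  obtain m y where w: "w = replicate m a @ y" "nonlead a y" by (rule lead_decomp)
  show ?thesis
  proof (cases y)
    case Nil
    then show ?thesis by (simp add: w reg_replicate)
  next
    case (Cons b y')
    have b: "b \<noteq> a" using w Cons by simp
    have "shsum (replicate m a) y' (\<lambda>q. g (b # q)) = shsum (replicate m a) y' (\<lambda>q. h (b # q))"
    proof (rule shsum_cong)
      fix q assume "q \<in> shuffles (replicate m a) y'"
      then have "ends C (b # q)"
        by (rule ends_Cons_shuffles) (use assms w Cons in \<open>auto simp: ends_replicate ends_appendD\<close>)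
      then show "g (b # q) = h (b # q)" using assms b by simp
    qed
    then show ?thesis by (simp add: w Cons reg_Cons[OF b])
  qed
qed


section \<open>Multiple polylogarithms as formal power series\<close>

definition fps_theta :: "real fps \<Rightarrow> real fps" where
  "fps_theta f = fps_X * fps_deriv f"

text \<open>Inverse of \<open>fps_theta\<close> on series without constant term; division by zero
  makes the constant term \<open>0\<close>.\<close>

definition fps_prim :: "real fps \<Rightarrow> real fps" where
  "fps_prim f = Abs_fps (\<lambda>n. f $ n / real n)"

definition fps_geo :: "real fps" where
  "fps_geo = Abs_fps (\<lambda>n. if n = 0 then 0 else 1)"

text \<open>Words are read from the last letter, that is \<open>polylog (rev (ew k))\<close> is the multiple
  polylogarithm of \<open>k\<close>; the sign \<open>(-1)^dep\<close> is left out here and put back in \<open>zeta_rev\<close>.\<close>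

fun polylog :: "word \<Rightarrow> real fps" where
  "polylog [] = 1"
| "polylog (E0 # w) = fps_prim (polylog w)"
| "polylog (E1 # w) = fps_prim (fps_geo * polylog w)"

lemma fps_theta_nth: "fps_theta f $ n = real n * f $ n"
  by (cases n) (auto simp: fps_theta_def)

lemma fps_theta_mult: "fps_theta (f * g) = fps_theta f * g + f * fps_theta g"
  by (simp add: fps_theta_def algebra_simps)

lemma fps_theta_add: "fps_theta (f + g) = fps_theta f + fps_theta g"
  by (simp add: fps_theta_def algebra_simps)

lemma fps_theta_zero [simp]: "fps_theta 0 = 0"
  by (simp add: fps_theta_def)

lemma fps_theta_inject:
  assumes "fps_theta f = fps_theta g" "f $ 0 = g $ 0"
  shows "f = g"
proof (rule fps_ext)
  fix n
  show "f $ n = g $ n"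
    using assms(2) arg_cong[OF assms(1), of "\<lambda>h. h $ n"] by (cases "n = 0") (auto simp: fps_theta_nth)
qed

lemma fps_theta_prim: "f $ 0 = 0 \<Longrightarrow> fps_theta (fps_prim f) = f"
  by (rule fps_ext) (auto simp: fps_theta_nth fps_prim_def)

lemma fps_geo_mult_nth: "(fps_geo * f) $ n = (\<Sum>m<n. f $ m)"
proof -
  have "(fps_geo * f) $ n = (\<Sum>i\<le>n. f $ i * fps_geo $ (n - i))"
    by (subst mult.commute) (simp add: fps_mult_nth atLeast0AtMost)
  also have "\<dots> = (\<Sum>i<n. f $ i * fps_geo $ (n - i))"
    by (simp add: lessThan_Suc_atMost[symmetric] fps_geo_def)
  also have "\<dots> = (\<Sum>m<n. f $ m)"
    by (intro sum.cong) (auto simp: fps_geo_def)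
  finally show ?thesis .
qed

lemma polylog_E0_nth: "polylog (E0 # w) $ n = polylog w $ n / real n"
  by (simp add: fps_prim_def)

lemma polylog_E1_nth: "polylog (E1 # w) $ n = (\<Sum>m<n. polylog w $ m) / real n"
  by (simp add: fps_prim_def fps_geo_mult_nth)

lemma polylog_nth_0: "w \<noteq> [] \<Longrightarrow> polylog w $ 0 = 0"
  by (cases w rule: polylog.cases) (auto simp: fps_prim_def)

text \<open>The forms dz/z and dz/(1-z) as seen by z d/dz: the factors 1 and z/(1-z).\<close>

definition kern :: "letter \<Rightarrow> real fps" where
  "kern a = (if a = E0 then 1 else fps_geo)"

lemma fps_theta_polylog:
  assumes "ends {E1} (a # w)"
  shows "fps_theta (polylog (a # w)) = kern a * polylog w"
proof (cases a)
  case E0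
  \<comment> \<open>This excludes \<open>[E0]\<close>: \<open>fps_prim\<close> would lose the
    constant term of \<open>polylog []\<close>.\<close>
  then have "w \<noteq> []" using assms by (auto simp: ends_def)
  then show ?thesis by (simp add: E0 kern_def fps_theta_prim polylog_nth_0)
next
  case E1
  then show ?thesis by (simp add: kern_def fps_theta_prim fps_geo_def)
qed

text \<open>The Leibniz rule for \<open>fps_theta\<close> reproduces the recursion of the shuffle
  product, and constant terms vanish for nonempty words.\<close>

lemma shsum_polylog:
  assumes "ends {E1} u" "ends {E1} v"
  shows "shsum u v polylog = polylog u * polylog v"
  using assms
proof (induction u v rule: shuffles.induct)
  case (3 a u b v)
  note u = \<open>ends {E1} (a # u)\<close> and v = \<open>ends {E1} (b # v)\<close>
  have "shsum u (b # v) (\<lambda>w. fps_theta (polylog (a # w))) = shsum u (b # v) (\<lambda>w. kern a * polylog w)"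
  proof (rule shsum_cong)
    fix w assume "w \<in> shuffles u (b # v)"
    then have "ends {E1} (a # w)"
      by (rule ends_Cons_shuffles[OF shuffles_commutes[THEN equalityD1, THEN subsetD]]) (use u v in auto)
    then show "fps_theta (polylog (a # w)) = kern a * polylog w" by (rule fps_theta_polylog)
  qed
  moreover have "shsum (a # u) v (\<lambda>w. fps_theta (polylog (b # w))) = shsum (a # u) v (\<lambda>w. kern b * polylog w)"
  proof (rule shsum_cong)
    fix w assume "w \<in> shuffles (a # u) v"
    then have "ends {E1} (b # w)"
      by (rule ends_Cons_shuffles) (use u v in auto)
    then show "fps_theta (polylog (b # w)) = kern b * polylog w" by (rule fps_theta_polylog)
  qed
  ultimately have "fps_theta (shsum (a # u) (b # v) polylog) =
      kern a * (polylog u * polylog (b # v)) + kern b * (polylog (a # u) * polylog v)"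
    using 3 ends_tl[OF u] ends_tl[OF v]
    by (simp add: shsum_additive[of fps_theta, symmetric] fps_theta_add shsum_cmult)
  also have "\<dots> = fps_theta (polylog (a # u) * polylog (b # v))"
    unfolding fps_theta_mult fps_theta_polylog[OF u] fps_theta_polylog[OF v] by (simp add: algebra_simps)
  finally show ?case
  proof (rule fps_theta_inject)
    have "shsum (a # u) (b # v) polylog $ 0 = shsum (a # u) (b # v) (\<lambda>w. polylog w $ 0)"
      by (subst shsum_additive[of "\<lambda>f. f $ 0"]) auto
    also have "\<dots> = shsum (a # u) (b # v) (\<lambda>w. 0)"
      by (rule shsum_cong) (auto intro: polylog_nth_0)
    finally show "shsum (a # u) (b # v) polylog $ 0 = (polylog (a # u) * polylog (b # v)) $ 0"
      by (simp add: polylog_nth_0 del: shsum.simps polylog.simps)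
  qed
qed auto

section \<open>Growth of the coefficients and convergence at z = 1\<close>

lemma polylog_nonneg: "polylog w $ n \<ge> 0"
  by (induction w arbitrary: n rule: polylog.induct)
     (auto simp: polylog_E0_nth polylog_E1_nth sum_nonneg simp del: polylog.simps(2,3))

lemma divide_nat_le: "0 \<le> x \<Longrightarrow> x / real n \<le> x"
  by (cases n) (auto simp: divide_le_eq mult_le_cancel_left1)

text \<open>Each letter costs at most a factor \<open>1 + harm n\<close>: \<open>E0\<close> does not
  increase coefficients, and \<open>E1\<close> sums the previous bound against
  \<open>1 / m\<close>.\<close>

lemma sum_polylog_le:
  "(\<Sum>m\<le>n. polylog w $ m) \<le> (1 + harm n) ^ length w"
proof (induction w arbitrary: n rule: polylog.induct)
  case 1
  then show ?case by (simp add: fps_one_nth)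
next
  case (2 w)
  have "(\<Sum>m\<le>n. polylog (E0 # w) $ m) \<le> (\<Sum>m\<le>n. polylog w $ m)"
  proof (rule sum_mono)
    fix m
    show "polylog (E0 # w) $ m \<le> polylog w $ m"
      unfolding polylog_E0_nth by (rule divide_nat_le[OF polylog_nonneg])
  qed
  also have "\<dots> \<le> (1 + harm n) ^ length w" by (rule 2)
  also have "\<dots> \<le> (1 + harm n) ^ length (E0 # w)"
    by (rule power_increasing) (auto simp: harm_nonneg)
  finally show ?case .
next
  case (3 w)
  have "(\<Sum>m\<le>n. polylog (E1 # w) $ m) = (\<Sum>m=1..n. polylog (E1 # w) $ m)"
    by (simp add: atMost_atLeast0 sum.atLeast_Suc_atMost polylog_nth_0 del: polylog.simps)
  also have "\<dots> \<le> (\<Sum>m=1..n. inverse (real m) * (1 + harm n) ^ length w)"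
  proof (rule sum_mono)
    fix m assume m: "m \<in> {1..n}"
    have "(\<Sum>i<m. polylog w $ i) \<le> (\<Sum>i\<le>n. polylog w $ i)"
      by (rule sum_mono2) (use m polylog_nonneg in auto)
    also have "\<dots> \<le> (1 + harm n) ^ length w" by (rule 3)
    finally have "(\<Sum>i<m. polylog w $ i) / real m \<le> (1 + harm n) ^ length w / real m"
      by (rule divide_right_mono) simp
    then show "polylog (E1 # w) $ m \<le> inverse (real m) * (1 + harm n) ^ length w"
      by (simp add: polylog_E1_nth field_simps del: polylog.simps)
  qed
  also have "\<dots> = harm n * (1 + harm n) ^ length w"
    by (simp add: harm_def sum_distrib_right)
  also have "\<dots> \<le> (1 + harm n) * (1 + harm n) ^ length w"
    by (rule mult_right_mono) (auto simp: harm_nonneg)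
  finally show ?case by simp
qed

lemma polylog_nth_le:
  assumes "ends {E1} w" "w \<noteq> []"
  shows "polylog w $ n \<le> (1 + harm n) ^ length w / real n"
  using assms
proof (induction w rule: polylog.induct)
  case (2 w)
  then have "w \<noteq> []" "ends {E1} w" by (auto simp: ends_def split: if_splits)
  then have "polylog (E0 # w) $ n \<le> (1 + harm n) ^ length w / real n"
    unfolding polylog_E0_nth using 2(1) divide_nat_le[OF polylog_nonneg] by (blast intro: order_trans)
  also have "\<dots> \<le> (1 + harm n) ^ length (E0 # w) / real n"
    by (intro divide_right_mono power_increasing) (auto simp: harm_nonneg)
  finally show ?case .
next
  case (3 w)
  have "(\<Sum>i<n. polylog w $ i) \<le> (\<Sum>i\<le>n. polylog w $ i)"
    by (rule sum_mono2) (use polylog_nonneg in auto)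
  also have "\<dots> \<le> (1 + harm n) ^ length w" by (rule sum_polylog_le)
  also have "\<dots> \<le> (1 + harm n) ^ length (E1 # w)"
    by (intro power_increasing) (auto simp: harm_nonneg)
  finally show ?case
    unfolding polylog_E1_nth by (rule divide_right_mono) simp
qed simp

lemma harm_power_bound:
  obtains c where "\<And>n. n > 0 \<Longrightarrow> (1 + harm n) ^ r \<le> c * real n powr (1/2)"
proof
  \<comment> \<open>Chosen so that the \<open>r\<close>-th power of \<open>n powr a\<close> stays
    below \<open>n powr (1/2)\<close>; two divisions by \<open>n\<close> then leave the summable
    \<open>n powr (-3/2)\<close>.\<close>
  define a :: real where "a = 1 / (2 * real (Suc r))"
  have a: "a > 0" "a * real r \<le> 1/2" by (auto simp: a_def field_simps)
  fix n :: nat assume n: "n > 0"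
  have ge1: "1 \<le> real n powr a" using n a by (simp add: ge_one_powr_ge_zero)
  have "harm n \<le> 1 + ln (real n)"
    using euler_mascheroni_sequence_decreasing[of 1 n] n by (simp add: harm_def)
  then have "1 + harm n \<le> 2 + ln (real n)" by simp
  also have "ln (real n) \<le> real n powr a / a"
    using n a by (intro ln_powr_bound) auto
  also have "2 + real n powr a / a \<le> (2 + 1 / a) * real n powr a"
    using ge1 by (simp add: algebra_simps)
  finally have "(1 + harm n) ^ r \<le> ((2 + 1 / a) * real n powr a) ^ r"
    by (intro power_mono) (auto simp: harm_nonneg add_nonneg_nonneg)
  also have "\<dots> = (2 + 1 / a) ^ r * real n powr (a * real r)"
    using n by (simp only: power_mult_distrib) (simp add: powr_power mult.commute)
  also have "\<dots> \<le> (2 + 1 / a) ^ r * real n powr (1/2)"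
    using a n by (intro mult_left_mono powr_mono zero_le_power) auto
  finally show "(1 + harm n) ^ r \<le> (2 + 1 / a) ^ r * real n powr (1/2)" .
qed

text \<open>The leading \<open>E0\<close> supplies a second division by \<open>n\<close> beyond the
  one in \<open>polylog_nth_le\<close>.\<close>

lemma summable_polylog:
  assumes "ends {E1} w" "nonlead E1 w"
  shows "summable (\<lambda>n. polylog w $ n)"
proof (cases w)
  case Nil
  have "summable (\<lambda>n. if n = 0 then 1 else 0 :: real)" by (rule summable_single)
  then show ?thesis by (simp add: Nil fps_one_nth)
next
  case (Cons b v)
  then have b: "b = E0" using assms by (cases b) auto
  then have v: "v \<noteq> []" "ends {E1} v" using assms Cons by (auto simp: ends_def split: if_splits)
  obtain c where c: "\<And>n. n > 0 \<Longrightarrow> (1 + harm n) ^ length v \<le> c * real n powr (1/2)"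
    using harm_power_bound by blast
  have le: "polylog w $ n \<le> c * real n powr (-3/2)" for n
  proof (cases "n = 0")
    case False
    have "polylog w $ n \<le> (1 + harm n) ^ length v / real n / real n"
      unfolding Cons b polylog_E0_nth
      by (intro divide_right_mono polylog_nth_le) (use v in auto)
    also have "\<dots> \<le> c * real n powr (1/2) / real n / real n"
      by (intro divide_right_mono c) (use False in auto)
    also have "\<dots> = c * real n powr (-3/2)"
      using False powr_diff[of "real n" "1/2" 2] by (simp add: power2_eq_square)
    finally show ?thesis .
  qed (simp add: Cons polylog_nth_0 del: polylog.simps)
  have "summable (\<lambda>n. c * real n powr (-3/2))"
    by (intro summable_mult) (simp add: summable_real_powr_iff)
  then show ?thesis
    by (rule summable_comparison_test') (use le polylog_nonneg in auto)
qed

lemma shsum_sums: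
  fixes f :: "'a list \<Rightarrow> nat \<Rightarrow> real"
  assumes "\<And>w. w \<in> shuffles u v \<Longrightarrow> f w sums s w"
  shows "(\<lambda>n. shsum u v (\<lambda>w. f w n)) sums shsum u v s"
  using assms
proof (induction u v arbitrary: f s rule: shuffles.induct)
  case (3 a u b v)
  have "(\<lambda>n. shsum u (b # v) (\<lambda>w. f (a # w) n)) sums shsum u (b # v) (\<lambda>w. s (a # w))"
    by (rule 3) (simp add: 3(3))
  moreover have "(\<lambda>n. shsum (a # u) v (\<lambda>w. f (b # w) n)) sums shsum (a # u) v (\<lambda>w. s (b # w))"
    by (rule 3) (simp add: 3(3))
  ultimately show ?case by (simp add: sums_add)
qed auto

definition zeta_rev :: "word \<Rightarrow> real" where
  "zeta_rev w = (-1) ^ count_list w E1 * (\<Sum>n. polylog w $ n)"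

lemma count_list_shuffles: "w \<in> shuffles u v \<Longrightarrow> count_list w a = count_list u a + count_list v a"
  by (induction u v arbitrary: w rule: shuffles.induct) auto

lemma shsum_zeta_rev:
  assumes u: "ends {E1} u" "nonlead E1 u" and v: "ends {E1} v" "nonlead E1 v"
  shows "shsum u v zeta_rev = zeta_rev u * zeta_rev v"
proof -
  let ?S = "\<lambda>w. \<Sum>n. polylog w $ n"
  have norm: "summable (\<lambda>n. norm (polylog w $ n))" if "ends {E1} w" "nonlead E1 w" for w
    using summable_polylog[OF that] by (simp add: polylog_nonneg)
  have "(\<lambda>n. shsum u v (\<lambda>w. polylog w $ n)) sums shsum u v ?S"
  proof (rule shsum_sums)
    fix w assume "w \<in> shuffles u v"
    then have "ends {E1} w" "nonlead E1 w"
      using ends_shuffles[OF _ u(1) v(1)] nonlead_shuffles[OF _ u(2) v(2)] by auto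
    then show "(\<lambda>n. polylog w $ n) sums ?S w"
      by (intro summable_sums summable_polylog)
  qed
  moreover have "(\<lambda>n. shsum u v (\<lambda>w. polylog w $ n)) = (\<lambda>n. \<Sum>i\<le>n. polylog u $ i * polylog v $ (n - i))"
  proof
    fix n
    have "shsum u v (\<lambda>w. polylog w $ n) = shsum u v polylog $ n"
      by (rule shsum_additive[of "\<lambda>f. f $ n"]) auto
    then show "shsum u v (\<lambda>w. polylog w $ n) = (\<Sum>i\<le>n. polylog u $ i * polylog v $ (n - i))"
      by (simp add: shsum_polylog u v fps_mult_nth atLeast0AtMost)
  qed
  ultimately have S: "shsum u v ?S = ?S u * ?S v"
    using sums_unique2[OF _ Cauchy_product_sums[OF norm[OF u] norm[OF v]]] by simp
  have "shsum u v zeta_rev = shsum u v (\<lambda>w. (-1) ^ (count_list u E1 + count_list v E1) * ?S w)"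
    by (rule shsum_cong) (auto simp: zeta_rev_def count_list_shuffles)
  then show ?thesis by (simp add: shsum_cmult S zeta_rev_def power_add)
qed

lemma zeta_rev_Nil [simp]: "zeta_rev [] = 1"
proof -
  have "(\<lambda>n. if n = 0 then (1::real) else 0) sums 1" by (rule sums_single)
  then have "(\<Sum>n. if n = 0 then (1::real) else 0) = 1" by (rule sums_unique[symmetric])
  then show ?thesis by (simp add: zeta_rev_def fps_one_nth)
qed

section \<open>Multiple zeta values and their shuffle regularization\<close>

text \<open>The \<open>0\<close> in front encodes positivity and gives the empty chain the last
  entry \<open>0\<close>, matching the constant series \<open>polylog []\<close>.\<close>

definition chains :: "nat \<Rightarrow> nat \<Rightarrow> nat list set" where
  "chains r n = {ns. length ns = r \<and> sorted_wrt (<) (0 # ns) \<and> last (0 # ns) = n}"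

lemma chains_0: "chains 0 n = (if n = 0 then {[]} else {})"
  by (auto simp: chains_def)

lemma chains_Suc: "chains (Suc r) n = (\<lambda>(m, ns). ns @ [n]) ` (SIGMA m:{..<n}. chains r m)"
proof (intro set_eqI iffI)
  fix ns assume ns: "ns \<in> chains (Suc r) n"
  then have "ns \<noteq> []" by (auto simp: chains_def)
  then obtain ms k where [simp]: "ns = ms @ [k]" by (metis rev_exhaust)
  from ns have k: "k = n" and s: "sorted_wrt (<) ((0 # ms) @ [n])" and l: "length ms = r"
    by (auto simp: chains_def)
  have "\<forall>x\<in>set (0 # ms). x < n"
    using s by (subst (asm) sorted_wrt_append) simp
  then have "last (0 # ms) < n"
    by (rule bspec) (rule last_in_set, simp)
  moreover have "ms \<in> chains r (last (0 # ms))"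
    using s l by (subst (asm) sorted_wrt_append) (auto simp: chains_def simp del: last.simps)
  ultimately show "ns \<in> (\<lambda>(m, ns). ns @ [n]) ` (SIGMA m:{..<n}. chains r m)"
    using k by (intro image_eqI[of _ _ "(last (0 # ms), ms)"]) auto
next
  fix ns assume "ns \<in> (\<lambda>(m, ns). ns @ [n]) ` (SIGMA m:{..<n}. chains r m)"
  then obtain m ms where ns: "ns = ms @ [n]" and m: "m < n" and ms: "ms \<in> chains r m" by auto
  have "x \<le> m" if "x \<in> set (0 # ms)" for x
  proof -
    have s: "sorted (0 # ms)" and l: "m = last (0 # ms)"
      using ms strict_sorted_imp_sorted[of "0 # ms"] by (simp_all add: chains_def)
    have "0 # ms = butlast (0 # ms) @ [m]" unfolding l by (rule append_butlast_last_id[symmetric]) simp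
    then have "sorted (butlast (0 # ms) @ [m])" and x: "x \<in> set (butlast (0 # ms) @ [m])"
      using s that by metis+
    then show ?thesis unfolding sorted_append by auto
  qed
  then have "sorted_wrt (<) ((0 # ms) @ [n])"
    using m ms by (subst sorted_wrt_append) (auto simp: chains_def dest: le_less_trans)
  then show "ns \<in> chains (Suc r) n" using ms by (auto simp: chains_def ns)
qed

lemma finite_chains: "finite (chains r n)"
  by (induction r arbitrary: n) (auto simp: chains_0 chains_Suc)

lemma sum_chains_Suc:
  "(\<Sum>ns\<in>chains (Suc r) n. f ns) = (\<Sum>m<n. \<Sum>ns\<in>chains r m. f (ns @ [n]))"
proof -
  have "inj_on (\<lambda>(m, ns). ns @ [n]) (SIGMA m:{..<n}. chains r m)"
    by (auto simp: inj_on_def chains_def)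
  then have "(\<Sum>ns\<in>chains (Suc r) n. f ns) = (\<Sum>(m, ns)\<in>(SIGMA m:{..<n}. chains r m). f (ns @ [n]))"
    by (simp add: chains_Suc sum.reindex case_prod_unfold)
  also have "\<dots> = (\<Sum>m<n. \<Sum>ns\<in>chains r m. f (ns @ [n]))"
    by (rule sum.Sigma[symmetric]) (auto simp: finite_chains)
  finally show ?thesis .
qed

lemma ew_append: "ew (k @ l) = ew k @ ew l"
  by (induction k) auto

lemma polylog_replicate_nth:
  "polylog (replicate j E0 @ E1 # w) $ n = (\<Sum>m<n. polylog w $ m) / real n ^ Suc j"
  by (induction j) (auto simp: polylog_E0_nth polylog_E1_nth simp del: polylog.simps)

lemma polylog_ew_nth:
  assumes "is_index k"
  shows "polylog (rev (ew k)) $ n = (\<Sum>ns\<in>chains (length k) n. \<Prod>i<length k. 1 / real (ns ! i) ^ (k ! i))"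
  using assms
proof (induction k arbitrary: n rule: rev_induct)
  case Nil
  then show ?case by (simp add: chains_0 fps_one_nth)
next
  case (snoc p k)
  then have p: "Suc (p - 1) = p" and k: "is_index k" by (auto simp: is_index_def)
  have "polylog (rev (ew (k @ [p]))) $ n = (\<Sum>m<n. polylog (rev (ew k)) $ m) / real n ^ p"
    using polylog_replicate_nth[of "p - 1" "rev (ew k)" n] p by (simp add: ew_append)
  also have "\<dots> = (\<Sum>m<n. \<Sum>ns\<in>chains (length k) m. (\<Prod>i<length k. 1 / real (ns ! i) ^ (k ! i)) / real n ^ p)"
    by (simp add: snoc.IH[OF k] sum_divide_distrib)
  also have "\<dots> = (\<Sum>m<n. \<Sum>ns\<in>chains (length k) m.
      \<Prod>i<length (k @ [p]). 1 / real ((ns @ [n]) ! i) ^ ((k @ [p]) ! i))"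
  proof (intro sum.cong refl)
    fix m ns assume "ns \<in> chains (length k) m"
    then have l: "length ns = length k" by (simp add: chains_def)
    have "(\<Prod>i<length k. 1 / real ((ns @ [n]) ! i) ^ ((k @ [p]) ! i)) = (\<Prod>i<length k. 1 / real (ns ! i) ^ (k ! i))"
      by (intro prod.cong) (auto simp: nth_append l)
    moreover have "(ns @ [n]) ! length k = n" using l by (metis nth_append_length)
    ultimately show "(\<Prod>i<length k. 1 / real (ns ! i) ^ (k ! i)) / real n ^ p =
        (\<Prod>i<length (k @ [p]). 1 / real ((ns @ [n]) ! i) ^ ((k @ [p]) ! i))"
      by simp
  qed
  finally show ?case by (simp add: sum_chains_Suc)
qed

text \<open>The terms are nonnegative, so the tuples may be grouped by their last entry; by
  \<open>polylog_ew_nth\<close> the groups sum to the coefficients.\<close>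

lemma mzv_eq_suminf:
  assumes k: "is_index k" and summ: "summable (\<lambda>n. polylog (rev (ew k)) $ n)"
  shows "mzv k = (\<Sum>n. polylog (rev (ew k)) $ n)"
proof -
  define r where "r = length k"
  define f where "f ns = (\<Prod>i<r. 1 / real (ns ! i) ^ (k ! i))" for ns
  define c where "c n = polylog (rev (ew k)) $ n" for n
  define B where "B = (SIGMA n:UNIV. chains r n)"
  have f0: "f ns \<ge> 0" for ns by (auto simp: f_def intro: prod_nonneg)
  have c0: "c n \<ge> 0" for n by (simp add: c_def polylog_nonneg)
  have inner: "((\<lambda>ns. f (snd (n, ns))) has_sum c n) (chains r n)" for n
  proof -
    have "c n = sum f (chains r n)" by (simp add: c_def f_def r_def polylog_ew_nth[OF k])
    then show ?thesis using has_sum_finite[OF finite_chains, of f r n] by simp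
  qed
  have outer: "(c has_sum suminf c) UNIV"
  proof (rule norm_summable_imp_has_sum)
    show "summable (\<lambda>n. norm (c n))" using summ by (simp add: c_def polylog_nonneg)
    show "c sums suminf c" using summ unfolding c_def by (rule summable_sums)
  qed
  have "(\<lambda>p. f (snd p)) summable_on B"
    unfolding B_def
  proof (rule summable_on_SigmaI)
    show "c summable_on UNIV" using outer by (rule has_sum_imp_summable)
  qed (rule inner, rule f0)
  then have "((\<lambda>p. f (snd p)) has_sum suminf c) B"
    unfolding B_def by (rule has_sum_SigmaI[OF inner outer])
  moreover have "inj_on snd B"
  proof (rule inj_onI)
    have last: "fst p = last (0 # snd p)" if "p \<in> B" for p
      using that by (cases p) (simp add: B_def chains_def)
    fix p q assume "p \<in> B" "q \<in> B" "snd p = snd q"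
    then show "p = q" using last[of p] last[of q] by (simp add: prod_eq_iff)
  qed
  ultimately have "(f has_sum suminf c) (snd ` B)"
    by (subst has_sum_reindex) (simp_all add: o_def)
  moreover have "snd ` B = {ns. length ns = length k \<and> sorted_wrt (<) ns \<and> (\<forall>x\<in>set ns. 0 < x)}"
  proof (intro set_eqI iffI)
    fix ns :: "nat list" assume "ns \<in> {ns. length ns = length k \<and> sorted_wrt (<) ns \<and> (\<forall>x\<in>set ns. 0 < x)}"
    then have "(last (0 # ns), ns) \<in> B" by (simp add: B_def chains_def r_def)
    then show "ns \<in> snd ` B" by (rule image_eqI[rotated]) simp
  next
    fix ns assume "ns \<in> snd ` B"
    then obtain n where "ns \<in> chains r n" unfolding B_def by auto
    then show "ns \<in> {ns. length ns = length k \<and> sorted_wrt (<) ns \<and> (\<forall>x\<in>set ns. 0 < x)}"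
      by (simp add: chains_def r_def)
  qed
  ultimately have "infsum f {n. length n = length k \<and> sorted_wrt (<) n \<and> (\<forall>x\<in>set n. 0 < x)} = suminf c"
    by (intro infsumI) simp
  then show ?thesis
    unfolding mzv_def f_def r_def c_def .
qed

section \<open>Indices correspond to words that do not begin with \<open>E0\<close>\<close>

lemma replicate_nonlead_inject:
  assumes "replicate i a @ x = replicate j a @ y" "nonlead a x" "nonlead a y"
  shows "i = j \<and> x = y"
  using assms
proof (induction i arbitrary: j)
  case 0
  then show ?case by (cases j) auto
next
  case (Suc i)
  obtain j' where "j = Suc j'" using Suc.prems by (cases j) auto
  then show ?case using Suc.IH[of j'] Suc.prems by simp
qed

lemma nonlead_ew: "nonlead E0 (ew k)"
  by (cases k) (auto simp: nonlead_def)

lemma ew_inject: "is_index k \<Longrightarrow> is_index l \<Longrightarrow> ew k = ew l \<Longrightarrow> k = l"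
proof (induction k arbitrary: l)
  case Nil
  then show ?case by (cases l) auto
next
  case (Cons p k)
  then obtain q l' where [simp]: "l = q # l'" by (cases l) auto
  have "p - 1 = q - 1 \<and> ew k = ew l'"
    by (rule replicate_nonlead_inject[OF _ nonlead_ew nonlead_ew]) (use Cons.prems(3) in simp)
  then show ?case using Cons.prems Cons.IH[of l'] by (auto simp: is_index_def)
qed

lemma ew_surj:
  assumes "nonlead E0 w"
  obtains k where "is_index k" "ew k = w"
  using assms
proof (induction "length w" arbitrary: w thesis rule: less_induct)
  case less
  show ?case
  proof (cases w)
    case Nil
    then show ?thesis using less.prems(1)[of "[]"] by (auto simp: is_index_def)
  next
    case (Cons b v)
    then have b: "b = E1" using less.prems(2) by (cases b) auto
    obtain m y where v: "v = replicate m E0 @ y" "nonlead E0 y" by (rule lead_decomp)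
    obtain k where "is_index k" "ew k = y"
      using less.hyps[of y] v Cons by auto
    then show ?thesis using less.prems(1)[of "Suc m # k"] v Cons b by (auto simp: is_index_def)
  qed
qed

lemma idx_of_ew: "is_index k \<Longrightarrow> idx_of (ew k) = k"
  unfolding idx_of_def by (rule the_equality) (simp_all add: ew_inject)

lemma dep_w_ew: "dep_w (ew k) = length k"
proof -
  have "count_list (replicate j E0) E1 = 0" for j by (induction j) auto
  then show ?thesis by (induction k) (auto simp: dep_w_def)
qed

lemma h1_iff_nonlead: "h1 w \<longleftrightarrow> nonlead E0 w"
  by (cases "hd w") (auto simp: h1_def nonlead_def)

lemma h1_iff_ends: "h1 w \<longleftrightarrow> ends {E1} (rev w)"
  by (auto simp: h1_def ends_def last_rev)

lemma h0_iff: "h0 w \<longleftrightarrow> ends {E1} (rev w) \<and> nonlead E1 (rev w)"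
  by (cases "last w") (auto simp: h0_def ends_def nonlead_def hd_rev last_rev)

lemma Zw_eq_zeta_rev:
  assumes "h0 w"
  shows "Zw w = zeta_rev (rev w)"
proof -
  have w: "ends {E1} (rev w)" "nonlead E1 (rev w)" using assms by (auto simp: h0_iff)
  then have "nonlead E0 w" using h1_iff_ends h1_iff_nonlead by blast
  then obtain k where k: "is_index k" "ew k = w" by (rule ew_surj)
  then have "Zw w = (-1) ^ count_list w E1 * (\<Sum>n. polylog (rev w) $ n)"
    using mzv_eq_suminf[OF k(1)] summable_polylog[OF w] idx_of_ew[OF k(1)]
    by (simp add: Zw_def dep_w_def k(2))
  then show ?thesis by (simp add: zeta_rev_def)
qed

text \<open>The definite description has exactly one solution: \<open>reg_hom\<close> gives
  existence, \<open>hom_eq_reg\<close> uniqueness. Both are applied to reversed words, where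
  trailing \<open>E1\<close> become leading letters.\<close>

lemma Zsh_0: "Zsh 0 = (\<lambda>w. if h1 w then reg E1 zeta_rev (rev w) else 0)"
  unfolding Zsh_def
proof (rule the_equality, intro conjI allI impI)
  let ?f = "\<lambda>w. if h1 w then reg E1 zeta_rev (rev w) else 0"
  show "?f [E1] = - 0"
    using reg_replicate[of E1 zeta_rev 1] by simp
  show "?f w = Zw w" if "h0 w" for w
    using that by (simp add: Zw_eq_zeta_rev h1_iff_ends h0_iff reg_nonlead)
  show "?f w = 0" if "\<not> h1 w" for w using that by simp
  show "sum_list (map ?f (shw u v)) = ?f u * ?f v" if uv: "h1 u" "h1 v" for u v
  proof -
    have "sum_list (map ?f (shw u v)) = shsum u v ?f" by (rule sum_list_shw)
    also have "\<dots> = shsum u v (\<lambda>w. reg E1 zeta_rev (rev w))"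
    proof (rule shsum_cong)
      fix w assume "w \<in> shuffles u v"
      then have "h1 w" using uv nonlead_shuffles by (auto simp: h1_iff_nonlead)
      then show "?f w = reg E1 zeta_rev (rev w)" by simp
    qed
    also have "\<dots> = shsum (rev u) (rev v) (reg E1 zeta_rev)" by (simp add: shsum_rev)
    also have "\<dots> = reg E1 zeta_rev (rev u) * reg E1 zeta_rev (rev v)"
      by (rule reg_hom[where C = "{E1}"]) (use uv in \<open>auto simp: shsum_zeta_rev h1_iff_ends\<close>)
    finally show ?thesis using uv by simp
  qed
next
  fix f :: "word \<Rightarrow> real"
  assume f: "f [E1] = - 0 \<and> (\<forall>w. h0 w \<longrightarrow> f w = Zw w) \<and>
      (\<forall>u v. h1 u \<longrightarrow> h1 v \<longrightarrow> sum_list (map f (shw u v)) = f u * f v) \<and> (\<forall>w. \<not> h1 w \<longrightarrow> f w = 0)"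
  define g where "g w = f (rev w)" for w
  have eq: "g w = zeta_rev w" if "ends {E1} w" "nonlead E1 w" for w
    using f that by (simp add: g_def h0_iff Zw_eq_zeta_rev)
  have hom: "shsum u v g = g u * g v" if "ends {E1} u" "ends {E1} v" for u v
  proof -
    have "shsum u v g = shsum (rev u) (rev v) f" by (simp add: g_def[abs_def] shsum_rev)
    then show ?thesis using f that by (simp add: g_def h1_iff_ends sum_list_shw)
  qed
  have "f w = reg E1 zeta_rev (rev w)" if "h1 w" for w
  proof -
    have w: "ends {E1} (rev w)" using that by (simp add: h1_iff_ends)
    have "g (rev w) = reg E1 g (rev w)"
      by (rule hom_eq_reg[OF hom _ _ _ w]) (use f eq[of "[]"] in \<open>auto simp: g_def ends_def nonlead_def\<close>)
    also have "\<dots> = reg E1 zeta_rev (rev w)"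
      by (rule reg_cong[OF eq _ _]) (use w in auto)
    finally show ?thesis by (simp add: g_def)
  qed
  then show "f = (\<lambda>w. if h1 w then reg E1 zeta_rev (rev w) else 0)" using f by auto
qed

text \<open>The functional \<open>F\<close> of the introduction: \<open>Zsh 0\<close> already covers
  trailing \<open>E1\<close>, and this step covers leading \<open>E0\<close>.\<close>

definition zreg :: "word \<Rightarrow> real" where
  "zreg = reg E0 (Zsh 0)"

lemma shsum_zreg: "shsum u v zreg = zreg u * zreg v"
  unfolding zreg_def
proof (rule reg_hom[where C = UNIV])
  fix u v :: word assume uv: "nonlead E0 u" "nonlead E0 v"
  have "shsum u v (Zsh 0) = shsum u v (\<lambda>w. reg E1 zeta_rev (rev w))"
  proof (rule shsum_cong)
    fix w assume "w \<in> shuffles u v"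
    then have "nonlead E0 w" using uv by (rule nonlead_shuffles)
    then show "Zsh 0 w = reg E1 zeta_rev (rev w)" by (simp add: Zsh_0 h1_iff_nonlead)
  qed
  also have "\<dots> = reg E1 zeta_rev (rev u) * reg E1 zeta_rev (rev v)"
    unfolding shsum_rev[symmetric]
    by (rule reg_hom[where C = "{E1}"]) (use uv in \<open>auto simp: shsum_zeta_rev h1_iff_ends[symmetric] h1_iff_nonlead\<close>)
  finally show "shsum u v (Zsh 0) = Zsh 0 u * Zsh 0 v" using uv by (simp add: Zsh_0 h1_iff_nonlead)
next
  show "Zsh 0 [] = 1" using reg_replicate[of E1 zeta_rev 0] by (simp add: Zsh_0 h1_def)
qed (auto simp: ends_def)

section \<open>The shifted and the symmetric values\<close>

lemma comps_0: "comps 0 m = (if m = 0 then {[]} else {})"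
  by (auto simp: comps_def)

lemma comps_Suc: "comps (Suc r) m = (\<lambda>(i, n). i # n) ` (SIGMA i:{..m}. comps r (m - i))"
proof (intro set_eqI iffI)
  fix n assume "n \<in> comps (Suc r) m"
  then obtain i n' where "n = i # n'" "length n' = r" "i + sum_list n' = m"
    by (cases n) (auto simp: comps_def)
  then show "n \<in> (\<lambda>(i, n). i # n) ` (SIGMA i:{..m}. comps r (m - i))"
    by (intro image_eqI[of _ _ "(i, n')"]) (auto simp: comps_def)
qed (auto simp: comps_def)

lemma finite_comps: "finite (comps r m)"
  by (induction r arbitrary: m) (auto simp: comps_0 comps_Suc)

lemma sum_comps_Suc:
  "(\<Sum>n\<in>comps (Suc r) m. f n) = (\<Sum>i\<le>m. \<Sum>n\<in>comps r (m - i). f (i # n))"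
proof -
  have "inj_on (\<lambda>(i, n). i # n) (SIGMA i:{..m}. comps r (m - i))"
    by (auto simp: inj_on_def)
  then have "(\<Sum>n\<in>comps (Suc r) m. f n) = (\<Sum>(i, n)\<in>(SIGMA i:{..m}. comps r (m - i)). f (i # n))"
    by (simp add: comps_Suc sum.reindex case_prod_unfold)
  also have "\<dots> = (\<Sum>i\<le>m. \<Sum>n\<in>comps r (m - i). f (i # n))"
    by (rule sum.Sigma[symmetric]) (auto simp: finite_comps)
  finally show ?thesis .
qed

lemma bcoef_Cons: "bcoef (p # k) (i # n) = real ((p + i - 1) choose i) * bcoef k n"
  by (simp add: bcoef_def prod.lessThan_Suc_shift del: prod.lessThan_Suc)

lemma oplus_Cons: "oplus (p # k) (i # n) = (p + i) # oplus k n"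
  by (simp add: oplus_def)

text \<open>The new letters spread over the blocks of zeros; merging \<open>i\<close> of them into a
  block of \<open>p - 1\<close> gives \<open>(p + i - 1) choose i\<close>, a factor of
  \<open>bcoef\<close>. In the induction, the prefix of length \<open>j\<close> is the block behind
  the preceding \<open>E1\<close>.\<close>

lemma shsum_E0_ew:
  assumes "is_index k"
  shows "shsum (replicate c E0) (replicate j E0 @ ew k) h =
    (\<Sum>i\<le>c. real ((i + j) choose i) * (\<Sum>n\<in>comps (length k) (c - i).
        bcoef k n * h (replicate (i + j) E0 @ ew (oplus k n))))"
  using assms
proof (induction k arbitrary: c j h)
  case Nil
  have "(\<Sum>i\<le>c. real ((i + j) choose i) * (\<Sum>n\<in>comps (length []) (c - i).
        bcoef [] n * h (replicate (i + j) E0 @ ew (oplus [] n)))) =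
      (\<Sum>i\<le>c. if i = c then real ((c + j) choose c) * h (replicate (c + j) E0) else 0)"
    by (intro sum.cong) (auto simp: comps_0 bcoef_def oplus_def)
  then show ?case by (simp add: shsum_replicate)
next
  case (Cons p k)
  then have k: "is_index k" and p: "p > 0" by (auto simp: is_index_def)
  have "shsum (replicate c E0) (replicate j E0 @ ew (p # k)) h =
      (\<Sum>i\<le>c. real ((i + j) choose i) *
        shsum (replicate (c - i) E0) (replicate (p - 1) E0 @ ew k) (\<lambda>s. h (replicate (i + j) E0 @ E1 # s)))"
    unfolding ew.simps shsum_append_Cons dcsum_def
    by (intro sum.cong) (auto simp: take_replicate drop_replicate min_def shsum_replicate)
  also have "\<dots> = (\<Sum>i\<le>c. real ((i + j) choose i) * (\<Sum>n\<in>comps (length (p # k)) (c - i).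
        bcoef (p # k) n * h (replicate (i + j) E0 @ ew (oplus (p # k) n))))"
  proof (intro sum.cong refl arg_cong2[where f = "(*)"])
    fix i
    show "shsum (replicate (c - i) E0) (replicate (p - 1) E0 @ ew k) (\<lambda>s. h (replicate (i + j) E0 @ E1 # s)) =
        (\<Sum>n\<in>comps (length (p # k)) (c - i). bcoef (p # k) n * h (replicate (i + j) E0 @ ew (oplus (p # k) n)))"
      unfolding Cons.IH[OF k] length_Cons sum_comps_Suc
      unfolding sum_distrib_left bcoef_Cons oplus_Cons ew.simps
      using p by (intro sum.cong refl) (simp add: add.commute)
  qed
  finally show ?case .
qed

lemma length_oplus: "n \<in> comps (length k) m \<Longrightarrow> length (oplus k n) = length k"
  by (simp add: comps_def oplus_def)

lemma is_index_oplus: "is_index k \<Longrightarrow> is_index (oplus k n)"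
  by (auto simp: is_index_def oplus_def set_zip)

text \<open>For nonempty \<open>k\<close>, \<open>reg\<close> shuffles the \<open>m\<close> leading
  zeros into the word behind its first \<open>E1\<close>, up to sign; by \<open>shsum_E0_ew\<close>
  this is the binomial sum defining \<open>shift_c\<close>.\<close>

lemma shift_c_zreg:
  assumes "is_index k"
  shows "shift_c k 0 m = (-1) ^ length k * ((-1) ^ m * zreg (replicate m E0 @ ew k))"
proof (cases k)
  case Nil
  have "Zsh 0 [] = 1" using reg_replicate[of E1 zeta_rev 0] by (simp add: Zsh_0 h1_def)
  then show ?thesis
    by (simp add: Nil shift_c_def comps_0 bcoef_def oplus_def zeta_sh_def zreg_def reg_replicate)
next
  case (Cons p ks)
  then have ks: "is_index ks" and p: "p > 0" using assms by (auto simp: is_index_def)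
  have "shift_c k 0 m = (\<Sum>n\<in>comps (length k) m. (-1) ^ length k * (bcoef k n * Zsh 0 (ew (oplus k n))))"
    unfolding shift_c_def zeta_sh_def by (intro sum.cong) (auto simp: length_oplus)
  also have "\<dots> = (-1) ^ length k * (\<Sum>n\<in>comps (length k) m. bcoef k n * Zsh 0 (ew (oplus k n)))"
    by (simp add: sum_distrib_left)
  also have "(\<Sum>n\<in>comps (length k) m. bcoef k n * Zsh 0 (ew (oplus k n))) =
      shsum (replicate m E0) (replicate (p - 1) E0 @ ew ks) (\<lambda>q. Zsh 0 (E1 # q))"
    unfolding Cons shsum_E0_ew[OF ks] length_Cons sum_comps_Suc
    unfolding sum_distrib_left bcoef_Cons oplus_Cons ew.simps
    using p by (intro sum.cong refl) (simp add: add.commute)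
  also have "\<dots> = (-1) ^ m * zreg (replicate m E0 @ ew k)"
    unfolding Cons zreg_def ew.simps by (subst reg_Cons) simp_all
  finally show ?thesis .
qed

lemma length_ew: "is_index k \<Longrightarrow> length (ew k) = wt k"
  by (induction k) (auto simp: is_index_def wt_def)

lemma ew_rev: "E1 # rev (ew (rev k)) = ew k @ [E1]"
  by (induction k) (auto simp: ew_append)

text \<open>The extra \<open>E1\<close> provides \<open>length k + 1\<close> cuts, one for each
  splitting of \<open>k\<close>; by \<open>ew_rev\<close> it also lets reversal of words match
  reversal of indices.\<close>

lemma cutsum_ew:
  "cutsum E1 (ew k @ E1 # replicate b E0) h =
     (\<Sum>i\<le>length k. h (ew (take i k)) (rev (replicate b E0 @ ew (rev (drop i k)))))"
proof (induction k arbitrary: h)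
  case Nil
  have "cutsum E1 (replicate b E0) f = 0" for f :: "letter list \<Rightarrow> letter list \<Rightarrow> 'a"
    using cutsum_append[of E1 "replicate b E0" "[]" f] by simp
  then show ?case by (simp add: cutsum_Cons)
next
  case (Cons p k)
  have eq: "replicate (p - 1) E0 @ ew k @ E1 # replicate b E0 = rev (replicate b E0 @ ew (rev (p # k)))"
  proof -
    have "ew k @ E1 # replicate b E0 = (ew k @ [E1]) @ replicate b E0" by simp
    also have "\<dots> = E1 # rev (ew (rev k)) @ replicate b E0" by (simp only: ew_rev[symmetric]) simp
    finally show ?thesis by (simp add: ew_append)
  qed
  have "cutsum E1 (ew (p # k) @ E1 # replicate b E0) h = h [] (replicate (p - 1) E0 @ ew k @ E1 # replicate b E0)
      + (\<Sum>i\<le>length k. h (ew (p # take i k)) (rev (replicate b E0 @ ew (rev (drop i k)))))"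
    by (simp add: cutsum_Cons cutsum_append Cons.IH)
  then show ?case
    unfolding eq by (simp add: sum.atMost_Suc_shift del: sum.atMost_Suc ew.simps(2))
qed

lemma is_index_take: "is_index k \<Longrightarrow> is_index (take i k)"
  and is_index_drop: "is_index k \<Longrightarrow> is_index (drop i k)"
  and is_index_rev: "is_index (rev k) \<longleftrightarrow> is_index k"
  by (auto simp: is_index_def dest: in_set_takeD in_set_dropD)

text \<open>The antipode sign is \<open>(-1) ^ (b + wt (drop i k))\<close>: the part in
  \<open>b\<close> cancels the sign from \<open>shift_c_zreg\<close>, the rest is the sign in
  \<open>zetaS\<close>.\<close>

lemma zetaS_eq_cutconv:
  assumes k: "is_index k"
  shows "zetaS 0 0 k a b =
    (-1) ^ length k * cutconv E1 zreg (replicate a E0 @ ew k @ E1 # replicate b E0)"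
proof -
  have "zetaS 0 0 k a b = (\<Sum>i\<le>length k. (-1) ^ length k * (zreg (replicate a E0 @ ew (take i k)) *
      ((-1) ^ (b + wt (drop i k)) * zreg (replicate b E0 @ ew (rev (drop i k))))))"
    unfolding zetaS_def
  proof (intro sum.cong refl)
    fix i assume "i \<in> {..length k}"
    then have "length k = length (take i k) + length (rev (drop i k))" by simp
    then have "(-1::real) ^ length k = (-1) ^ length (take i k) * (-1) ^ length (rev (drop i k))"
      by (metis power_add)
    moreover have "(-1::real) ^ a * ((-1) ^ a * x) = x" for x
      by (simp add: mult.assoc[symmetric] power_mult_distrib[symmetric])
    ultimately show "(-1) ^ wt (drop i k) * ((-1) ^ a * shift_c (take i k) 0 a) * shift_c (rev (drop i k)) 0 b =
      (-1) ^ length k * (zreg (replicate a E0 @ ew (take i k)) *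
      ((-1) ^ (b + wt (drop i k)) * zreg (replicate b E0 @ ew (rev (drop i k)))))"
      using shift_c_zreg[OF is_index_take[OF k], of i a]
        shift_c_zreg[of "rev (drop i k)" b] is_index_drop[OF k, of i]
      by (simp add: is_index_rev power_add mult.left_commute[of "(-1) ^ length (take i k)"] del: length_take length_drop)
  qed
  also have "\<dots> = (-1) ^ length k * (\<Sum>i\<le>length k. zreg (replicate a E0 @ ew (take i k)) *
      ((-1) ^ (b + wt (drop i k)) * zreg (replicate b E0 @ ew (rev (drop i k)))))"
    by (simp add: sum_distrib_left)
  also have "(\<Sum>i\<le>length k. zreg (replicate a E0 @ ew (take i k)) *
      ((-1) ^ (b + wt (drop i k)) * zreg (replicate b E0 @ ew (rev (drop i k))))) =
      cutconv E1 zreg (replicate a E0 @ ew k @ E1 # replicate b E0)"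
  proof -
    have "length (rev (replicate b E0 @ ew (rev (drop i k)))) = b + wt (drop i k)" for i
      using is_index_drop[OF k, of i] length_ew[of "rev (drop i k)"]
      by (simp add: is_index_rev) (simp add: wt_def)
    then show ?thesis
      unfolding cutconv_def by (simp add: cutsum_append cutsum_ew add.commute)
  qed
  finally show ?thesis .
qed

section \<open>The shifted shuffle product in terms of shuffle sums\<close>

lemma lin_append: "lin f (xs @ ys) = lin f xs + lin f ys"
  by (simp add: lin_def)

lemma lin_word_lc_to_idx: "lin f (word_lc_to_idx X) = lin (\<lambda>w. (-1) ^ dep_w w * f (idx_of w)) X"
  unfolding lin_def word_lc_to_idx_def by (simp add: o_def case_prod_unfold mult_ac)

lemma lin_map_Cons: "lin f (map (\<lambda>(c, w). (- c, E0 # w)) X) = - lin (\<lambda>w. f (E0 # w)) X"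
  unfolding lin_def by (induction X) auto

lemma lin_shw_single: "lin f (shw_lc [(c, u)] [(d, v)]) = c * d * shsum u v f"
  by (simp add: lin_def shw_lc_def o_def sum_list_const_mult sum_list_shw)

lemma geo_e0_idx: "geo_e0 (idx_to_ser k) m = [((-1) ^ length k, replicate m E0 @ ew k)]"
proof -
  have "concat (map (\<lambda>j. map (\<lambda>(c, w). (c, replicate j E0 @ w)) (idx_to_ser k (m - j))) [0..<m]) = []"
    by (auto simp: idx_to_ser_def)
  then show ?thesis by (simp add: geo_e0_def idx_to_ser_def)
qed

lemma ser_shw_idx: "ser_shw (idx_to_ser l) V m = shw_lc [((-1) ^ length l, ew l)] (V m)"
proof -
  have "concat (map (\<lambda>i. shw_lc (idx_to_ser l i) (V (m - i))) [Suc 0..<Suc m]) = []"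
    by (auto simp: idx_to_ser_def shw_lc_def)
  then show ?thesis
    unfolding ser_shw_def by (subst upt_conv_Cons) (simp_all add: idx_to_ser_def del: upt_Suc)
qed

definition shs_term :: "word \<Rightarrow> word \<Rightarrow> nat \<Rightarrow> (word \<Rightarrow> real) \<Rightarrow> real" where
  "shs_term u v m g = shsum u (replicate m E0 @ v) g
     - (if m = 0 then 0 else shsum u (replicate (m - 1) E0 @ v) (\<lambda>w. g (E0 # w)))"

lemma lin_shs:
  "lin g (shs (idx_to_ser l) (idx_to_ser k) m) = (-1) ^ (length l + length k) * shs_term (ew l) (ew k) m g"
  by (simp add: shs_def ome0_def lin_append lin_map_Cons ser_shw_idx geo_e0_idx lin_shw_single
      shs_term_def power_add algebra_simps lin_def[of _ "[]"])

text \<open>The list \<open>shs\<close> contains words starting with \<open>E0\<close>, on which \<open>idx_of\<close> is a junk value; they cancel.\<close>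

lemma shs_term_cong:
  assumes u: "nonlead E0 u" and v: "nonlead E0 v" and g: "\<And>w. nonlead E0 w \<Longrightarrow> g w = g' w"
  shows "shs_term u v m g = shs_term u v m g'"
proof (cases m)
  case 0
  have "shsum u v g = shsum u v g'"
    by (rule shsum_cong) (use nonlead_shuffles[OF _ u v] g in auto)
  then show ?thesis by (simp add: 0 shs_term_def)
next
  case (Suc m')
  \<comment> \<open>Shuffles beginning with an \<open>E0\<close> of the second word cancel against
    the subtracted sum; the others begin with the first letter of \<open>u\<close>, which is not
    \<open>E0\<close>.\<close>
  have "shs_term u v m f = (case u of [] \<Rightarrow> 0 | c # u' \<Rightarrow> shsum u' (replicate m E0 @ v) (\<lambda>w. f (c # w)))" for f
    by (cases u) (auto simp: shs_term_def Suc)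
  then show ?thesis using u g by (auto split: list.split)
qed

lemma zetaS_shs_eq:
  assumes k: "is_index k" and l: "is_index l"
  shows "zetaS_shs 0 0 l k a b = (-1) ^ (length l + length k) *
    shsum (ew l) (replicate a E0 @ ew k) (\<lambda>p. cutconv E1 zreg (p @ E1 # replicate b E0))"
proof -
  define D where "D m w = cutconv E1 zreg (replicate (a - m) E0 @ w @ E1 # replicate b E0)" for m w
  define T where "T m = shsum (ew l) (replicate m E0 @ ew k) (D m)" for m
  have D: "(-1) ^ dep_w w * zetaS 0 0 (idx_of w) (a - m) b = D m w" if w: "nonlead E0 w" for m w
  proof -
    obtain j where j: "is_index j" "ew j = w" using w by (rule ew_surj)
    show ?thesis
      using idx_of_ew[OF j(1)] dep_w_ew[of j] zetaS_eq_cutconv[OF j(1), of "a - m" b]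
      by (simp add: D_def j(2) mult.assoc[symmetric] power_mult_distrib[symmetric])
  qed
  have step: "lin (\<lambda>j. zetaS 0 0 j (a - m) b) (idx_shs l k m) =
      (-1) ^ (length l + length k) * (T m - (if m = 0 then 0 else T (m - 1)))" if "m \<le> a" for m
  proof -
    have "lin (\<lambda>j. zetaS 0 0 j (a - m) b) (idx_shs l k m) =
        (-1) ^ (length l + length k) * shs_term (ew l) (ew k) m (D m)"
      unfolding idx_shs_def lin_word_lc_to_idx lin_shs
      by (subst shs_term_cong[OF nonlead_ew nonlead_ew D]) simp_all
    \<comment> \<open>The \<open>E0\<close> from the factor \<open>1 - e_0 s\<close> joins the
      prefix, so the subtracted part at \<open>m\<close> is \<open>T (m - 1)\<close>.\<close>
    moreover have "D m (E0 # w) = D (m - 1) w" if "m \<noteq> 0" for w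
    proof -
      have "a - (m - 1) = Suc (a - m)" using that \<open>m \<le> a\<close> by simp
      then show ?thesis by (simp add: D_def replicate_append_same[symmetric])
    qed
    ultimately show ?thesis by (simp add: shs_term_def T_def)
  qed
  have tele: "(\<Sum>m\<le>n. T m - (if m = 0 then 0 else T (m - 1))) = T n" for n
    by (induction n) auto
  have "zetaS_shs 0 0 l k a b = (\<Sum>m\<le>a. (-1) ^ (length l + length k) * (T m - (if m = 0 then 0 else T (m - 1))))"
    unfolding zetaS_shs_def by (intro sum.cong) (auto simp: step)
  also have "\<dots> = (-1) ^ (length l + length k) * T a"
    by (simp only: sum_distrib_left[symmetric] tele)
  finally show ?thesis by (simp add: T_def D_def[abs_def])
qed

theorem theorem1p2:
  fixes k l :: "nat list"
  assumes "is_index k" and "is_index l"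
  shows "\<forall>a b. zetaS_shs 0 0 l k a b =
     (-1) ^ wt l * (\<Sum>c\<le>b. \<Sum>n\<in>comps (length l) c.
        bcoef l n * zetaS 0 0 (k @ rev (oplus l n)) a (b - c))"
proof (intro allI)
  fix a b
  \<comment> \<open>The common depth sign: \<open>k @ rev (oplus l n)\<close> has length
    \<open>length l + length k\<close>.\<close>
  define s :: real where "s = (-1) ^ (length l + length k)"
  define H where "H q = cutconv E1 zreg (replicate a E0 @ ew k @ E1 # q)" for q
  have H: "s * H (rev (replicate i E0 @ ew (oplus l n))) = zetaS 0 0 (k @ rev (oplus l n)) a i"
    if "n \<in> comps (length l) c" for n c i
  proof -
    have "E1 # rev (replicate i E0 @ ew (oplus l n)) = ew (rev (oplus l n)) @ E1 # replicate i E0"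
      using ew_rev[of "rev (oplus l n)"] by simp
    moreover have "is_index (k @ rev (oplus l n))"
      using assms(1) is_index_oplus[OF assms(2), of n] by (auto simp: is_index_def)
    ultimately show ?thesis
      using length_oplus[OF that]
      by (simp add: zetaS_eq_cutconv H_def ew_append s_def add.commute del: rev_append)
  qed
  \<comment> \<open>The hypothesis of the transfer follows from \<open>shsum_cutconv\<close>, since
    \<open>p\<close> is nonempty and the other word contains the marked \<open>E1\<close>.\<close>
  have "shsum (ew l) (replicate a E0 @ ew k) (\<lambda>p. cutconv E1 zreg (p @ E1 # replicate b E0)) =
      (-1) ^ length (ew l) * shsum (rev (ew l)) (replicate b E0) (\<lambda>q. cutconv E1 zreg ((replicate a E0 @ ew k) @ E1 # q))"
    by (rule shsum_antipode_transfer) (simp add: shsum_cutconv shsum_zreg)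
  also have "\<dots> = (-1) ^ wt l * shsum (rev (ew l)) (rev (replicate b E0)) H"
    by (simp add: length_ew assms H_def[abs_def])
  also have "shsum (rev (ew l)) (rev (replicate b E0)) H = shsum (replicate b E0) (replicate 0 E0 @ ew l) (\<lambda>w. H (rev w))"
    unfolding shsum_rev by (simp add: shsum_commute)
  also have "\<dots> = (\<Sum>i\<le>b. \<Sum>n\<in>comps (length l) (b - i).
      bcoef l n * H (rev (replicate i E0 @ ew (oplus l n))))"
    unfolding shsum_E0_ew[OF assms(2)] by simp
  \<comment> \<open>Of the \<open>b\<close> zeros, \<open>c\<close> are absorbed by the blocks of
    \<open>l\<close>, and \<open>b - c\<close> stay outside as the new trailing zeros after
    reversal.\<close>
  also have "\<dots> = (\<Sum>c\<le>b. \<Sum>n\<in>comps (length l) c.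
      bcoef l n * H (rev (replicate (b - c) E0 @ ew (oplus l n))))"
    by (rule sum.reindex_bij_witness[of _ "\<lambda>c. b - c" "\<lambda>c. b - c"]) auto
  finally have "zetaS_shs 0 0 l k a b = (-1) ^ wt l * (\<Sum>c\<le>b. \<Sum>n\<in>comps (length l) c.
      bcoef l n * (s * H (rev (replicate (b - c) E0 @ ew (oplus l n)))))"
    by (simp add: zetaS_shs_eq assms s_def sum_distrib_left mult_ac)
  then show "zetaS_shs 0 0 l k a b = (-1) ^ wt l * (\<Sum>c\<le>b. \<Sum>n\<in>comps (length l) c.
        bcoef l n * zetaS 0 0 (k @ rev (oplus l n)) a (b - c))"
    by (simp add: H cong: sum.cong del: rev_append)
qed

end
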